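(* Let $K$ be a number field and $A$ an abelian variety of dimension $g$ over $K$ such that $\widehat{\rho}$ has big image. Then there is a constant $C>0$ depending only on $A$ such that for all sufficiently large primes $p$ and all Galois extensions $K_\infty/K$ with pro-$p$ Galois group, $\#A(K_\infty)_{\mathrm{tors}}<C$.
   Context: The adelic Galois representation $\widehat{\rho}:\mathrm{Gal}(\bar K/K)\to\mathrm{GSp}_{2g}(\widehat{\mathbb{Z}})$ is the Galois action on the full Tate module $T(A)=\varprojlim_m A[m]$ (with respect to a symplectic basis for the Weil pairing); with image $G$, $\widehat\rho$ has big image if $G\cap\mathrm{Sp}_{2g}(\widehat{\mathbb{Z}})$ has finite index in $\mathrm{Sp}_{2g}(\widehat{\mathbb{Z}})$. *)

theory Defs
  imports
    "HOL-Algebra.Algebra"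
    "HOL-Algebra.Algebraic_Closure_Type"
    "HOL-Library.Poly_Mapping"
    "HOL-Library.Extended_Nat"
    "Jordan_Normal_Form.Matrix"
begin

section \<open>Number fields, Galois groups, pro-p extensions\<close>

text \<open>Throughout, the type 'a plays the role of a fixed algebraic closure of K; all fields are
  subsets of it, and all varieties are identified with their sets of points over it.\<close>

abbreviation Kbar :: "'a::field ring" where
  "Kbar \<equiv> ring_of_type_algebra"

definition number_field :: "'a::field_char_0 set \<Rightarrow> bool" where
  "number_field K \<longleftrightarrow> subfield K Kbar \<and> ring.finite_dimension Kbar \<rat> K"

definition type_is_algebraic_closure :: "'a::alg_closed_field set \<Rightarrow> bool" where
  "type_is_algebraic_closure K \<longleftrightarrow> subfield K Kbar \<and> (\<forall>x. (ring.algebraic Kbar over K) x)"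

text \<open>The group of K-automorphisms of L (extensional functions on L).\<close>

definition Gal :: "'a::field set \<Rightarrow> 'a set \<Rightarrow> ('a \<Rightarrow> 'a) monoid" where
  "Gal L K = BijGroup L \<lparr>carrier := {\<sigma> \<in> Bij L.
      (\<forall>x\<in>L. \<forall>y\<in>L. \<sigma> (x + y) = \<sigma> x + \<sigma> y \<and> \<sigma> (x * y) = \<sigma> x * \<sigma> y) \<and> (\<forall>x\<in>K. \<sigma> x = x)}\<rparr>"

text \<open>Normality of L over K; separability is automatic in characteristic 0 and algebraicity of L
  over K is automatic inside an algebraic closure of K.\<close>

definition galois_extension :: "'a::{alg_closed_field, field_char_0} set \<Rightarrow> 'a set \<Rightarrow> bool" where
  "galois_extension L K \<longleftrightarrow> subfield L Kbar \<and> K \<subseteq> L \<and>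
     (\<forall>f \<in> carrier (univ_poly Kbar K). ring_irreducible\<^bsub>univ_poly Kbar K\<^esub> f \<longrightarrow>
        (\<exists>x\<in>L. ring.is_root Kbar f x) \<longrightarrow> {x. ring.is_root Kbar f x} \<subseteq> L)"

definition krull_open :: "'a::field set \<Rightarrow> 'a set \<Rightarrow> ('a \<Rightarrow> 'a) set \<Rightarrow> bool" where
  "krull_open L K U \<longleftrightarrow> U \<subseteq> carrier (Gal L K) \<and>
     (\<forall>\<sigma>\<in>U. \<exists>S. finite S \<and> S \<subseteq> L \<and> (\<forall>\<tau>\<in>carrier (Gal L K). (\<forall>x\<in>S. \<tau> x = \<sigma> x) \<longrightarrow> \<tau> \<in> U))"

text \<open>The Galois group of a Galois extension is profinite, so it is pro-p iff all of its open
  normal subgroups have p-power index.\<close>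

definition pro_p_Gal :: "nat \<Rightarrow> 'a::field set \<Rightarrow> 'a set \<Rightarrow> bool" where
  "pro_p_Gal p L K \<longleftrightarrow>
     (\<forall>N. N \<lhd> Gal L K \<and> krull_open L K N \<longrightarrow> (\<exists>k. card (rcosets\<^bsub>Gal L K\<^esub> N) = p ^ k))"


section \<open>Projective varieties and morphisms\<close>

type_synonym ('v, 'a) mvpoly = "('v \<Rightarrow>\<^sub>0 nat) \<Rightarrow>\<^sub>0 'a"
type_synonym 'a ppoint = "(nat \<Rightarrow> 'a) set"

definition peval :: "('v, 'a::comm_semiring_1) mvpoly \<Rightarrow> ('v \<Rightarrow> 'a) \<Rightarrow> 'a" where
  "peval p v = (\<Sum>m\<in>Poly_Mapping.keys p. Poly_Mapping.lookup p m *
     (\<Prod>i\<in>Poly_Mapping.keys m. v i ^ Poly_Mapping.lookup m i))"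

text \<open>A point of projective space: the set of all its homogeneous coordinate vectors, which are
  extended by 0 beyond the last coordinate.\<close>

definition proj_point :: "(nat \<Rightarrow> 'a::field) \<Rightarrow> 'a ppoint" where
  "proj_point v = {\<lambda>i. c * v i | c. c \<noteq> 0}"

definition proj_space :: "nat \<Rightarrow> 'a::field ppoint set" where
  "proj_space n = proj_point ` {v. (\<exists>i. v i \<noteq> 0) \<and> (\<forall>i>n. v i = 0)}"

definition form_over :: "'a::field set \<Rightarrow> nat \<Rightarrow> nat \<Rightarrow> (nat, 'a) mvpoly \<Rightarrow> bool" where
  "form_over F n d p \<longleftrightarrow> (\<forall>m\<in>Poly_Mapping.keys p. Poly_Mapping.lookup p m \<in> F \<and>
     Poly_Mapping.keys m \<subseteq> {..n} \<and>
     (\<Sum>i\<in>Poly_Mapping.keys m. Poly_Mapping.lookup m i) = d)"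

text \<open>Closed subsets of projective n-space cut out by forms with coefficients in F. For a perfect
  field F this is the same as being closed over the algebraic closure and defined over F.\<close>

definition proj_closed :: "'a::field set \<Rightarrow> nat \<Rightarrow> 'a ppoint set \<Rightarrow> bool" where
  "proj_closed F n Z \<longleftrightarrow> (\<exists>S. (\<forall>p\<in>S. \<exists>d. form_over F n d p) \<and>
     Z = {x \<in> proj_space n. \<forall>p\<in>S. \<forall>v\<in>x. peval p v = 0})"

definition irreducible_closed :: "nat \<Rightarrow> 'a::field ppoint set \<Rightarrow> bool" where
  "irreducible_closed n Z \<longleftrightarrow> proj_closed UNIV n Z \<and> Z \<noteq> {} \<and>
     (\<forall>Y W. proj_closed UNIV n Y \<and> proj_closed UNIV n W \<and> Z \<subseteq> Y \<union> W \<longrightarrow> Z \<subseteq> Y \<or> Z \<subseteq> W)"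

definition zariski_dim :: "nat \<Rightarrow> 'a::field ppoint set \<Rightarrow> enat" where
  "zariski_dim n V = (SUP k \<in> {k. \<exists>Z. (\<forall>i\<le>k. irreducible_closed n (Z i) \<and> Z i \<subseteq> V) \<and>
     (\<forall>i<k. Z i \<subset> Z (Suc i))}. enat k)"

text \<open>F-morphisms from V to projective N-space. On an irreducible V, a tuple of forms representing
  the morphism near a point represents it wherever the tuple does not vanish.\<close>

definition morphism :: "'a::field set \<Rightarrow> nat \<Rightarrow> 'a ppoint set \<Rightarrow> nat \<Rightarrow> ('a ppoint \<Rightarrow> 'a ppoint) \<Rightarrow> bool" where
  "morphism F n V N \<phi> \<longleftrightarrow> (\<forall>x\<in>V. \<exists>d f. (\<forall>i\<le>N. form_over F n d (f i)) \<and>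
     (\<forall>v\<in>x. \<exists>i\<le>N. peval (f i) v \<noteq> 0) \<and>
     (\<forall>y\<in>V. \<forall>v\<in>y. (\<exists>i\<le>N. peval (f i) v \<noteq> 0) \<longrightarrow>
        \<phi> y = proj_point (\<lambda>i. if i \<le> N then peval (f i) v else 0)))"

text \<open>The same for V x V, with bihomogeneous forms in two groups of variables.\<close>

definition biform_over :: "'a::field set \<Rightarrow> nat \<Rightarrow> nat \<Rightarrow> nat \<Rightarrow> (nat + nat, 'a) mvpoly \<Rightarrow> bool" where
  "biform_over F n d e p \<longleftrightarrow> (\<forall>m\<in>Poly_Mapping.keys p. Poly_Mapping.lookup p m \<in> F \<and>
     Poly_Mapping.keys m \<subseteq> {..n} <+> {..n} \<and>
     (\<Sum>i\<le>n. Poly_Mapping.lookup m (Inl i)) = d \<and>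
     (\<Sum>i\<le>n. Poly_Mapping.lookup m (Inr i)) = e)"

definition morphism2 ::
  "'a::field set \<Rightarrow> nat \<Rightarrow> 'a ppoint set \<Rightarrow> nat \<Rightarrow> ('a ppoint \<Rightarrow> 'a ppoint \<Rightarrow> 'a ppoint) \<Rightarrow> bool" where
  "morphism2 F n V N \<phi> \<longleftrightarrow> (\<forall>x\<in>V. \<forall>y\<in>V. \<exists>d e f. (\<forall>i\<le>N. biform_over F n d e (f i)) \<and>
     (\<forall>v\<in>x. \<forall>w\<in>y. \<exists>i\<le>N. peval (f i) (case_sum v w) \<noteq> 0) \<and>
     (\<forall>x'\<in>V. \<forall>y'\<in>V. \<forall>v\<in>x'. \<forall>w\<in>y'. (\<exists>i\<le>N. peval (f i) (case_sum v w) \<noteq> 0) \<longrightarrow>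
        \<phi> x' y' = proj_point (\<lambda>i. if i \<le> N then peval (f i) (case_sum v w) else 0)))"

definition closed_embedding :: "nat \<Rightarrow> 'a::field ppoint set \<Rightarrow> nat \<Rightarrow> ('a ppoint \<Rightarrow> 'a ppoint) \<Rightarrow> bool" where
  "closed_embedding n V N j \<longleftrightarrow> morphism UNIV n V N j \<and> proj_closed UNIV N (j ` V) \<and>
     (\<exists>\<psi>. morphism UNIV N (j ` V) n \<psi> \<and> (\<forall>x\<in>V. \<psi> (j x) = x))"


section \<open>Abelian varieties\<close>

definition rational_points :: "'a set \<Rightarrow> 'a ppoint monoid \<Rightarrow> 'a ppoint set" where
  "rational_points L A = {x \<in> carrier A. \<exists>v\<in>x. range v \<subseteq> L}"

text \<open>An abelian variety over K: a geometrically integral closed subvariety of projective n-space,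
  defined over K, with a commutative group law given by K-morphisms.\<close>

definition abelian_variety :: "'a::field set \<Rightarrow> nat \<Rightarrow> 'a ppoint monoid \<Rightarrow> bool" where
  "abelian_variety K n A \<longleftrightarrow>
     proj_closed K n (carrier A) \<and> irreducible_closed n (carrier A) \<and>
     comm_group A \<and> \<one>\<^bsub>A\<^esub> \<in> rational_points K A \<and>
     morphism2 K n (carrier A) n (\<lambda>x y. x \<otimes>\<^bsub>A\<^esub> y) \<and>
     morphism K n (carrier A) n (\<lambda>x. inv\<^bsub>A\<^esub> x)"

definition torsion_points :: "('b, 'c) monoid_scheme \<Rightarrow> 'b set" where
  "torsion_points A = {x \<in> carrier A. \<exists>m::nat. m > 0 \<and> x [^]\<^bsub>A\<^esub> m = \<one>\<^bsub>A\<^esub>}"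

definition mtorsion :: "('b, 'c) monoid_scheme \<Rightarrow> nat \<Rightarrow> 'b set" where
  "mtorsion A m = {x \<in> carrier A. x [^]\<^bsub>A\<^esub> m = \<one>\<^bsub>A\<^esub>}"

definition gal_act :: "('a \<Rightarrow> 'a) \<Rightarrow> 'a ppoint \<Rightarrow> 'a ppoint" where
  "gal_act \<sigma> x = (\<lambda>v. \<sigma> \<circ> v) ` x"


section \<open>Divisors and polarizations\<close>

text \<open>Nonzero rational functions on an irreducible V are represented by functions on points, of
  which only the values on some nonempty open subset matter.\<close>

definition generically :: "nat \<Rightarrow> 'a::field ppoint set \<Rightarrow> ('a ppoint \<Rightarrow> bool) \<Rightarrow> bool" where
  "generically n V P \<longleftrightarrow> (\<exists>Z. proj_closed UNIV n Z \<and> \<not> V \<subseteq> Z \<and> (\<forall>u\<in>V - Z. P u))"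

definition generic_quotient ::
  "nat \<Rightarrow> 'a::field ppoint set \<Rightarrow> ('a ppoint \<Rightarrow> 'a) \<Rightarrow> (nat, 'a) mvpoly \<Rightarrow> (nat, 'a) mvpoly \<Rightarrow> bool" where
  "generic_quotient n V h p q \<longleftrightarrow> (\<exists>d. form_over UNIV n d p \<and> form_over UNIV n d q) \<and>
     generically n V (\<lambda>u. \<forall>v\<in>u. peval p v \<noteq> 0 \<and> peval q v \<noteq> 0 \<and> h u = peval p v / peval q v)"

definition ratfun :: "nat \<Rightarrow> 'a::field ppoint set \<Rightarrow> ('a ppoint \<Rightarrow> 'a) \<Rightarrow> bool" where
  "ratfun n V h \<longleftrightarrow> (\<exists>p q. generic_quotient n V h p q)"

definition unit_at :: "nat \<Rightarrow> 'a::field ppoint set \<Rightarrow> 'a ppoint \<Rightarrow> ('a ppoint \<Rightarrow> 'a) \<Rightarrow> bool" where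
  "unit_at n V x h \<longleftrightarrow>
     (\<exists>p q. generic_quotient n V h p q \<and> (\<forall>v\<in>x. peval p v \<noteq> 0 \<and> peval q v \<noteq> 0))"

text \<open>A Cartier divisor D: for each point x a local equation D x, such that D x is also a local
  equation at all points near x. Two such families describe the same divisor iff all quotients of
  local equations are units.\<close>

type_synonym 'a divisor = "'a ppoint \<Rightarrow> 'a ppoint \<Rightarrow> 'a"

definition cartier_divisor :: "nat \<Rightarrow> 'a::field ppoint set \<Rightarrow> 'a divisor \<Rightarrow> bool" where
  "cartier_divisor n V D \<longleftrightarrow> (\<forall>x\<in>V. ratfun n V (D x)) \<and>
     (\<forall>x\<in>V. \<exists>Z. proj_closed UNIV n Z \<and> x \<notin> Z \<and>
        (\<forall>y\<in>V - Z. unit_at n V y (\<lambda>u. D x u / D y u)))"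

definition has_divisor :: "nat \<Rightarrow> 'a::field ppoint set \<Rightarrow> ('a ppoint \<Rightarrow> 'a) \<Rightarrow> 'a divisor \<Rightarrow> bool" where
  "has_divisor n V h D \<longleftrightarrow> ratfun n V h \<and> (\<forall>x\<in>V. unit_at n V x (\<lambda>u. h u / D x u))"

definition lin_equiv :: "nat \<Rightarrow> 'a::field ppoint set \<Rightarrow> 'a divisor \<Rightarrow> 'a divisor \<Rightarrow> bool" where
  "lin_equiv n V D E \<longleftrightarrow> (\<exists>h. has_divisor n V h (\<lambda>x u. D x u / E x u))"

text \<open>The pullback along j of the divisor of the i-th coordinate of the ambient projective space:
  near x the local equation is the i-th coordinate divided by one that does not vanish at j x.\<close>

definition coord_divisor :: "('a::field ppoint \<Rightarrow> 'a ppoint) \<Rightarrow> nat \<Rightarrow> 'a divisor" where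
  "coord_divisor j i x u =
     (let l = (LEAST l. \<exists>v\<in>j x. v l \<noteq> 0); v = (SOME v. v \<in> j u) in v i / v l)"

text \<open>D is ample: a positive multiple is linearly equivalent to a hyperplane section of a
  projective embedding.\<close>

definition ample :: "nat \<Rightarrow> 'a::field ppoint set \<Rightarrow> 'a divisor \<Rightarrow> bool" where
  "ample n V D \<longleftrightarrow> cartier_divisor n V D \<and>
     (\<exists>k N j i. k > 0 \<and> closed_embedding n V N j \<and> i \<le> N \<and> (\<exists>x\<in>V. \<exists>v\<in>j x. v i \<noteq> 0) \<and>
        lin_equiv n V (\<lambda>x u. D x u ^ k) (coord_divisor j i))"

text \<open>t_Q^* D - D, where t_Q is translation by Q; its class is the image of Q under the
  homomorphism from A to the dual of A attached to D.\<close>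

definition phi_divisor :: "'a::field ppoint monoid \<Rightarrow> 'a divisor \<Rightarrow> 'a ppoint \<Rightarrow> 'a divisor" where
  "phi_divisor A D Q x u = D (x \<otimes>\<^bsub>A\<^esub> Q) (u \<otimes>\<^bsub>A\<^esub> Q) / D x u"

definition conj_divisor :: "('a \<Rightarrow> 'a) \<Rightarrow> 'a::field divisor \<Rightarrow> 'a divisor" where
  "conj_divisor \<sigma> D x u = \<sigma> (D (gal_act (inv_into UNIV \<sigma>) x) (gal_act (inv_into UNIV \<sigma>) u))"

text \<open>A polarization of A over K: an ample D over the algebraic closure whose associated
  homomorphism to the dual abelian variety commutes with the Galois action.\<close>

definition polarization :: "'a::field set \<Rightarrow> nat \<Rightarrow> 'a ppoint monoid \<Rightarrow> 'a divisor \<Rightarrow> bool" where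
  "polarization K n A D \<longleftrightarrow> ample n (carrier A) D \<and>
     (\<forall>\<sigma>\<in>carrier (Gal UNIV K). \<forall>Q\<in>carrier A.
        lin_equiv n (carrier A) (phi_divisor A (conj_divisor \<sigma> D) Q) (phi_divisor A D Q))"

text \<open>The Weil pairing on m-torsion attached to D: if h has divisor [m]^*(t_Q^* D - D), then
  h(u + P) = e_m(P, Q) h(u).\<close>

definition weil_pairing ::
  "nat \<Rightarrow> 'a::field ppoint monoid \<Rightarrow> 'a divisor \<Rightarrow> nat \<Rightarrow> 'a ppoint \<Rightarrow> 'a ppoint \<Rightarrow> 'a" where
  "weil_pairing n A D m P Q = (THE z. \<exists>h.
     has_divisor n (carrier A) h
       (\<lambda>x u. phi_divisor A D Q (x [^]\<^bsub>A\<^esub> m) (u [^]\<^bsub>A\<^esub> m)) \<and>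
     generically n (carrier A) (\<lambda>u. h (u \<otimes>\<^bsub>A\<^esub> P) = z * h u))"


section \<open>Profinite integers and symplectic groups\<close>

text \<open>Compatible systems of residues; the residue mod m is represented in the range from 0 to m - 1,
  and the meaningless component at m = 0 is set to 0.\<close>

typedef zhat = "{a :: nat \<Rightarrow> int. a 0 = 0 \<and> (\<forall>m n. 0 < n \<and> m dvd n \<longrightarrow> a n mod int m = a m)}"
  morphisms residue Abs_zhat
  by (rule exI[of _ "\<lambda>_. 0"]) simp

setup_lifting type_definition_zhat

instantiation zhat :: comm_ring_1
begin

lift_definition zero_zhat :: zhat is "\<lambda>m. 0" by simp

lift_definition one_zhat :: zhat is "\<lambda>m. if m = 0 then 0 else 1 mod int m"
  by (auto simp: mod_mod_cancel)

lift_definition plus_zhat :: "zhat \<Rightarrow> zhat \<Rightarrow> zhat" is "\<lambda>a b m. (a m + b m) mod int m"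
  by (auto simp: mod_mod_cancel) (metis mod_add_eq)

lift_definition times_zhat :: "zhat \<Rightarrow> zhat \<Rightarrow> zhat" is "\<lambda>a b m. (a m * b m) mod int m"
  by (auto simp: mod_mod_cancel) (metis mod_mult_eq)

lift_definition uminus_zhat :: "zhat \<Rightarrow> zhat" is "\<lambda>a m. (- a m) mod int m"
  by (auto simp: mod_mod_cancel) (metis mod_minus_eq)

lift_definition minus_zhat :: "zhat \<Rightarrow> zhat \<Rightarrow> zhat" is "\<lambda>a b m. (a m - b m) mod int m"
  by (auto simp: mod_mod_cancel) (metis mod_diff_eq)

lemma zhat_eqI: "(\<And>m. m > 0 \<Longrightarrow> residue a m = residue b m) \<Longrightarrow> a = b"
  by transfer (metis (no_types, lifting) ext gr0I mem_Collect_eq)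

lemma residue_mod: "m > 0 \<Longrightarrow> residue a m mod int m = residue a m"
  by transfer auto

instance
proof
  fix a b c :: zhat
  show "a * b * c = a * (b * c)"
    by (rule zhat_eqI) (simp add: times_zhat.rep_eq mod_simps mult.assoc)
  show "a * b = b * a"
    by (rule zhat_eqI) (simp add: times_zhat.rep_eq mult.commute)
  show "1 * a = a"
    by (rule zhat_eqI) (simp add: times_zhat.rep_eq one_zhat.rep_eq residue_mod mod_simps)
  show "a + b + c = a + (b + c)"
    by (rule zhat_eqI) (simp add: plus_zhat.rep_eq mod_simps add.assoc)
  show "a + b = b + a"
    by (rule zhat_eqI) (simp add: plus_zhat.rep_eq add.commute)
  show "0 + a = a"
    by (rule zhat_eqI) (simp add: plus_zhat.rep_eq zero_zhat.rep_eq residue_mod)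
  show "- a + a = 0"
    by (rule zhat_eqI) (simp add: plus_zhat.rep_eq uminus_zhat.rep_eq zero_zhat.rep_eq mod_simps)
  show "a - b = a + - b"
    by (rule zhat_eqI) (simp add: plus_zhat.rep_eq uminus_zhat.rep_eq minus_zhat.rep_eq mod_simps)
  show "(a + b) * c = a * c + b * c"
    by (rule zhat_eqI) (simp add: plus_zhat.rep_eq times_zhat.rep_eq mod_simps algebra_simps)
  show "(0::zhat) \<noteq> 1"
  proof
    assume "(0::zhat) = 1"
    then have "residue 0 2 = residue 1 2" by simp
    then show False by (simp add: zero_zhat.rep_eq one_zhat.rep_eq)
  qed
qed

end

text \<open>The standard symplectic form, with blocks 0, 1, -1, 0 of size g.\<close>

definition symp_form :: "nat \<Rightarrow> nat \<Rightarrow> nat \<Rightarrow> int" where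
  "symp_form g i j = (if j = i + g then 1 else if i = j + g then -1 else 0)"

definition symp_mat :: "nat \<Rightarrow> 'r::comm_ring_1 mat" where
  "symp_mat g = mat (2 * g) (2 * g) (\<lambda>(i, j). of_int (symp_form g i j))"

definition Sp :: "nat \<Rightarrow> zhat mat monoid" where
  "Sp g = \<lparr>carrier = {M \<in> carrier_mat (2 * g) (2 * g). M\<^sup>T * symp_mat g * M = symp_mat g},
           monoid.mult = (*), one = 1\<^sub>m (2 * g)\<rparr>"


section \<open>Tate module and adelic representation\<close>

text \<open>Compatible systems of torsion points; the meaningless component at m = 0 is set to the
  neutral element.\<close>

definition tate_module :: "('b, 'c) monoid_scheme \<Rightarrow> (nat \<Rightarrow> 'b) monoid" where
  "tate_module A = \<lparr>carrier = {t. t 0 = \<one>\<^bsub>A\<^esub> \<and> (\<forall>m>0. t m \<in> mtorsion A m) \<and>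
       (\<forall>m n. 0 < n \<and> m dvd n \<longrightarrow> t n [^]\<^bsub>A\<^esub> (n div m) = t m)},
     monoid.mult = (\<lambda>s t m. s m \<otimes>\<^bsub>A\<^esub> t m), one = (\<lambda>m. \<one>\<^bsub>A\<^esub>)\<rparr>"

definition zhat_scale :: "('b, 'c) monoid_scheme \<Rightarrow> zhat \<Rightarrow> (nat \<Rightarrow> 'b) \<Rightarrow> nat \<Rightarrow> 'b" where
  "zhat_scale A a t m = t m [^]\<^bsub>A\<^esub> residue a m"

text \<open>A basis of the Tate module as the inverse limit of the A[m]: elements whose components at
  level m form a basis of the Z/m-module A[m], for every m > 0.\<close>

definition tate_basis :: "('b, 'c) monoid_scheme \<Rightarrow> nat \<Rightarrow> (nat \<Rightarrow> nat \<Rightarrow> 'b) \<Rightarrow> bool" where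
  "tate_basis A r b \<longleftrightarrow> (\<forall>i<r. b i \<in> carrier (tate_module A)) \<and>
     (\<forall>m>0. bij_betw (\<lambda>c. \<Otimes>\<^bsub>A\<^esub>i\<in>{..<r}. b i m [^]\<^bsub>A\<^esub> (c i :: nat))
        ({..<r} \<rightarrow>\<^sub>E {..<m}) (mtorsion A m))"

text \<open>A generator of the Tate module of the multiplicative group.\<close>

definition compatible_roots_of_unity :: "(nat \<Rightarrow> 'a::field) \<Rightarrow> bool" where
  "compatible_roots_of_unity \<zeta> \<longleftrightarrow> (\<forall>m>0. \<forall>k::nat. \<zeta> m ^ k = 1 \<longleftrightarrow> m dvd k) \<and>
     (\<forall>m n. 0 < n \<and> m dvd n \<longrightarrow> \<zeta> n ^ (n div m) = \<zeta> m)"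

text \<open>Existence of a symplectic basis forces the pairing on the Tate module to be perfect, that is,
  the polarization to be principal.\<close>

definition symplectic_tate_basis ::
  "nat \<Rightarrow> 'a::field ppoint monoid \<Rightarrow> 'a divisor \<Rightarrow> nat \<Rightarrow> (nat \<Rightarrow> nat \<Rightarrow> 'a ppoint) \<Rightarrow> bool" where
  "symplectic_tate_basis n A D g b \<longleftrightarrow> tate_basis A (2 * g) b \<and>
     (\<exists>\<zeta>. compatible_roots_of_unity \<zeta> \<and>
        (\<forall>m>0. \<forall>i<2 * g. \<forall>j<2 * g.
           weil_pairing n A D m (b i m) (b j m) = \<zeta> m powi symp_form g i j))"

text \<open>The matrix of \<sigma> acting on the Tate module; its j-th column contains the coordinates of the
  image of the j-th basis vector.\<close>

definition adelic_rep ::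
  "'a::field ppoint monoid \<Rightarrow> nat \<Rightarrow> (nat \<Rightarrow> nat \<Rightarrow> 'a ppoint) \<Rightarrow> ('a \<Rightarrow> 'a) \<Rightarrow> zhat mat" where
  "adelic_rep A g b \<sigma> = (THE M. M \<in> carrier_mat (2 * g) (2 * g) \<and>
     (\<forall>j<2 * g. (\<lambda>m. gal_act \<sigma> (b j m)) =
        (\<Otimes>\<^bsub>tate_module A\<^esub>i\<in>{..<2 * g}. zhat_scale A (M $$ (i, j)) (b i))))"

definition big_image ::
  "'a::field set \<Rightarrow> 'a ppoint monoid \<Rightarrow> nat \<Rightarrow> (nat \<Rightarrow> nat \<Rightarrow> 'a ppoint) \<Rightarrow> bool" where
  "big_image K A g b \<longleftrightarrow>
     finite (rcosets\<^bsub>Sp g\<^esub> (adelic_rep A g b ` carrier (Gal UNIV K) \<inter> carrier (Sp g)))"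

end

theory Submission
  imports Defs
begin

text \<open>Let \<open>H\<close> be the intersection of the adelic image with the symplectic group. As \<open>H\<close> has finite index,
  it contains the block matrices with blocks \<open>1, r, 0, 1\<close> and \<open>1, 0, s, 1\<close> for some \<open>r, s > 0\<close>; let
  \<open>\<sigma>\<close> and \<open>\<tau>\<close> be Galois elements acting in this way. If \<open>L\<close> is pro-\<open>p\<close> over \<open>K\<close> and \<open>x\<close> is a
  torsion point over \<open>L\<close>, then some power \<open>p ^ k\<close> of every Galois element fixes \<open>x\<close>. For \<open>\<sigma>\<close> and \<open>\<tau>\<close> this
  shows that \<open>r s p ^ k\<close> kills \<open>x\<close>. To get rid of \<open>p ^ k\<close> when \<open>p\<close> does not divide \<open>r s\<close>, use the
  hyperbolic element \<open>\<sigma> \<tau>\<close>: its characteristic polynomial is a power of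
  \<open>T\<^sup>2 - (2 + r s) T + 1\<close>, whose value at \<open>1\<close> is \<open>- r s\<close>, so \<open>\<sigma> \<tau>\<close> cannot act on nonzero
  \<open>p\<close>-torsion with \<open>p\<close>-power order. Hence all torsion over \<open>L\<close> lies in \<open>A[r s]\<close>.\<close>

section \<open>Periodic linear recurrences modulo a prime\<close>

text \<open>With \<open>E\<close> the shift by \<open>s\<close>, this is the binomial expansion of
  \<open>(E - 1) ^ k\<close>. The sign is written \<open>(-1) ^ (k + i)\<close> rather than with
  \<open>k - i\<close> to avoid truncated subtraction.\<close>

lemma funpow_difference_eq_sum:
  fixes f :: "nat \<Rightarrow> int"
  shows "((\<lambda>h m. h (m + s) - h m) ^^ k) f n = (\<Sum>i\<le>k. (-1) ^ (k + i) * int (k choose i) * f (n + s * i))"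
proof (induction k arbitrary: n)
  case (Suc k)
  let ?S = "\<lambda>n. \<Sum>i\<le>k. (-1) ^ (k + i) * int (k choose i) * f (n + s * i)"
  \<comment> \<open>After a shift of the index, Pascal's rule splits each coefficient; the two
    halves are the expansions at \<open>n + s\<close> and at \<open>n\<close>.\<close>
  have "(\<Sum>i\<le>Suc k. (-1) ^ (Suc k + i) * int (Suc k choose i) * f (n + s * i))
      = (-1) ^ Suc k * f n + (\<Sum>i\<le>k. (-1) ^ (k + i) * int (k choose i) * f (n + s * Suc i)
          + (-1) ^ (k + i) * int (k choose Suc i) * f (n + s * Suc i))"
    by (subst sum.atMost_Suc_shift) (simp add: algebra_simps)
  also have "\<dots> = ?S (n + s) + ((-1) ^ Suc k * f n + (\<Sum>i\<le>k. (-1) ^ (k + i) * int (k choose Suc i) * f (n + s * Suc i)))"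
    by (simp add: sum.distrib algebra_simps)
  also have "(-1) ^ Suc k * f n + (\<Sum>i\<le>k. (-1) ^ (k + i) * int (k choose Suc i) * f (n + s * Suc i))
      = - (\<Sum>i\<le>Suc k. (-1) ^ (k + i) * int (k choose i) * f (n + s * i))"
    by (subst sum.atMost_Suc_shift) (simp add: sum_negf)
  also have "\<dots> = - ?S n"
    by simp
  finally show ?case
    using Suc.IH by simp
qed simp

text \<open>Of the binomial expansion only the two end terms survive modulo \<open>p\<close>,
  because \<open>p\<close> divides \<open>p choose i\<close> for \<open>0 < i < p\<close>.\<close>

lemma funpow_difference_prime_cong:
  fixes f :: "nat \<Rightarrow> int"
  assumes "Factorial_Ring.prime p"
  shows "int p dvd ((\<lambda>h m. h (m + s) - h m) ^^ p) f n - (f (n + s * p) - f n)"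
proof -
  let ?t = "\<lambda>i. (-1) ^ (p + i) * int (p choose i) * f (n + s * i)"
  have p: "p > 1" "p > 0" using assms prime_gt_1_nat prime_gt_0_nat by auto
  have "{..p} = insert 0 (insert p {0<..<p})" using p by auto
  then have "(\<Sum>i\<le>p. ?t i) = ?t 0 + (?t p + (\<Sum>i\<in>{0<..<p}. ?t i))"
    using p by simp
  moreover have "int p dvd (\<Sum>i\<in>{0<..<p}. ?t i)"
    by (intro dvd_sum dvd_mult2 dvd_mult) (use assms in \<open>auto intro!: int_dvd_int_iff[THEN iffD2] dvd_choose_prime\<close>)
  moreover have "?t p = f (n + s * p)" by (simp flip: mult_2)
  \<comment> \<open>The constant term should carry the sign -1. For odd \<open>p\<close> it does;
    for \<open>p = 2\<close> the expression is \<open>2 * f n\<close>.\<close>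
  moreover have "int p dvd (-1) ^ p * f n + f n"
  proof (cases "p = 2")
    case False
    then have "odd p" using assms primes_dvd_imp_eq two_is_prime_nat by blast
    then show ?thesis by simp
  qed simp
  moreover have "?t 0 = (-1) ^ p * f n" by simp
  ultimately have "(\<Sum>i\<le>p. ?t i) - (f (n + s * p) - f n) = ((-1) ^ p * f n + f n) + (\<Sum>i\<in>{0<..<p}. ?t i)"
    "int p dvd ((-1) ^ p * f n + f n) + (\<Sum>i\<in>{0<..<p}. ?t i)"
    by linarith (rule dvd_add; fact)
  then show ?thesis
    by (simp only: funpow_difference_eq_sum)
qed

lemma funpow_difference_cong:
  fixes f h :: "nat \<Rightarrow> int"
  assumes "\<And>n. d dvd f n - h n"
  shows "d dvd ((\<lambda>h m. h (m + s) - h m) ^^ k) f n - ((\<lambda>h m. h (m + s) - h m) ^^ k) h n"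
proof (induction k arbitrary: n)
  case (Suc k)
  show ?case
    using dvd_diff[OF Suc.IH[of "n + s"] Suc.IH[of n]] by (simp add: algebra_simps)
qed (use assms in simp)

text \<open>Frobenius for the shift \<open>E\<close> by 1: modulo \<open>p\<close>,
  \<open>(E - 1) ^ (p ^ k)\<close> is \<open>E ^ (p ^ k) - 1\<close>. The induction on
  \<open>k\<close> uses the prime case with step \<open>p ^ k\<close>.\<close>

lemma funpow_difference_prime_power_cong:
  fixes f :: "nat \<Rightarrow> int"
  assumes "Factorial_Ring.prime p"
  shows "int p dvd ((\<lambda>h m. h (m + 1) - h m) ^^ (p ^ k)) f n - (f (n + p ^ k) - f n)"
proof (induction k arbitrary: f n)
  case (Suc k)
  note IH = Suc.IH
  let ?D = "\<lambda>s (h :: nat \<Rightarrow> int) m. h (m + s) - h m"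
  \<comment> \<open>The induction hypothesis holds for every function, so it applies to each iterate
    \<open>?h\<close> in turn and replaces the factors \<open>?D 1 ^^ (p ^ k)\<close> one by one by
    differences of step \<open>p ^ k\<close>.\<close>
  have *: "int p dvd ((?D 1 ^^ (p ^ k)) ^^ j) f n - (?D (p ^ k) ^^ j) f n" for j n
  proof (induction j arbitrary: n)
    case (Suc j)
    let ?h = "((?D 1 ^^ (p ^ k)) ^^ j) f"
    let ?u = "(?D (p ^ k) ^^ j) f"
    have "int p dvd (?D 1 ^^ (p ^ k)) ?h n - (?h (n + p ^ k) - ?h n)"
      by (rule IH)
    from dvd_add[OF this dvd_diff[OF Suc.IH[of "n + p ^ k"] Suc.IH[of n]]]
    show ?case
      by (simp add: algebra_simps)
  qed simp
  have "?D 1 ^^ (p ^ Suc k) = (?D 1 ^^ (p ^ k)) ^^ p"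
    by (simp only: funpow_mult power_Suc mult.commute[of p])
  then show ?case
    using dvd_add[OF *[of p n] funpow_difference_prime_cong[OF assms, of "p ^ k" f n]]
    by (simp add: mult.commute algebra_simps)
qed simp

text \<open>Modulo \<open>p\<close> the difference operator \<open>\<Delta>\<close> satisfies \<open>\<Delta>\<^sup>q f = f(\<cdot> + q) - f\<close> for \<open>q = p ^ k\<close>, whereas the
  recursion gives \<open>\<Delta>\<^sup>2 f = J f(\<cdot> + 1)\<close> with \<open>J\<close> invertible.\<close>

lemma periodic_recurrence_dvd:
  fixes f :: "nat \<Rightarrow> int"
  assumes p: "Factorial_Ring.prime p" and J: "\<not> int p dvd J"
    and rec: "\<And>n. f (n + 2) = (2 + J) * f (n + 1) - f n"
    and per: "\<And>n. int p dvd f (n + p ^ k) - f n"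
  shows "int p dvd f n"
proof -
  let ?D = "\<lambda>(h :: nat \<Rightarrow> int) m. h (m + 1) - h m"
  have D2: "(?D ^^ (2 * j)) f n = J ^ j * f (n + j)" for j n
  proof (induction j arbitrary: n)
    case (Suc j)
    have "(?D ^^ (2 * Suc j)) f n = ?D (?D ((?D ^^ (2 * j)) f)) n"
      by simp
    also have "\<dots> = J ^ j * (f (n + j + 2) - 2 * f (n + j + 1) + f (n + j))"
      unfolding Suc.IH by (simp add: algebra_simps)
    also have "\<dots> = J ^ Suc j * f (n + Suc j)"
      by (simp only: rec) (simp add: algebra_simps)
    finally show ?case .
  qed simp
  have D0: "int p dvd (?D ^^ (p ^ k)) f n" for n
    using dvd_add[OF funpow_difference_prime_power_cong[OF p, of k f n] per[of n]] by simp
  \<comment> \<open>\<open>D2\<close> treats even exponents and \<open>p ^ k\<close> may be odd, so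
    the difference is taken another \<open>p ^ k\<close> times, of a function that already vanishes
    modulo \<open>p\<close>.\<close>
  have "int p dvd (?D ^^ (p ^ k)) ((?D ^^ (p ^ k)) f) n - (?D ^^ (p ^ k)) (\<lambda>_. 0) n"
    by (rule funpow_difference_cong) (simp only: D0 diff_zero)
  moreover have "(?D ^^ (p ^ k)) (\<lambda>_. 0) n = 0"
    by (simp only: funpow_difference_eq_sum) simp
  ultimately have "int p dvd (?D ^^ (p ^ k)) ((?D ^^ (p ^ k)) f) n"
    by (simp only: diff_zero)
  then have "int p dvd (?D ^^ (2 * p ^ k)) f n"
    by (simp add: mult_2 funpow_add)
  then have "int p dvd J ^ p ^ k * f (n + p ^ k)"
    by (simp only: D2)
  then have "int p dvd f (n + p ^ k)"
    using p J by (simp add: prime_dvd_mult_iff prime_dvd_power_iff prime_gt_0_nat)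
  then show ?thesis
    using per[of n] by (metis dvd_diff diff_diff_eq2 add_diff_cancel_left')
qed

text \<open>Descent on the size of \<open>m\<close>. If \<open>p\<close> divides \<open>m\<close>,
  the preceding lemma makes every value divisible by \<open>p\<close>, and both \<open>f\<close> and
  \<open>m\<close> can be divided by \<open>p\<close>. Otherwise \<open>m\<close> is coprime to
  \<open>p ^ l\<close>, and \<open>tor\<close> gives the claim.\<close>

lemma periodic_recurrence_dvd_modulus:
  fixes f :: "nat \<Rightarrow> int"
  assumes p: "Factorial_Ring.prime p" and J: "\<not> int p dvd J"
    and rec: "\<And>n. f (n + 2) = (2 + J) * f (n + 1) - f n"
    and per: "\<And>n. m dvd f (n + p ^ k) - f n"
    and tor: "\<And>n. m dvd int p ^ l * f n"
  shows "m dvd f n"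
  using rec per tor
proof (induction "nat \<bar>m\<bar>" arbitrary: f n m rule: less_induct)
  case less
  note prems = less.prems
  \<comment> \<open>The case \<open>m = 0\<close> is split off because division by \<open>p\<close>
    would not make it smaller; there \<open>tor\<close> says \<open>p ^ l * f n = 0\<close>.\<close>
  consider "m = 0" | "m \<noteq> 0" "int p dvd m" | "\<not> int p dvd m" by blast
  then show ?case
  proof cases
    case 1
    then show ?thesis using prems(3)[of n] p by (simp add: prime_gt_0_nat)
  next
    case 2
    then obtain m' where m: "m = int p * m'" by blast
    have p0: "int p \<noteq> 0" using p by (simp add: prime_gt_0_nat)
    have "int p dvd f n" for n
      using periodic_recurrence_dvd[OF p J prems(1)] prems(2) 2(2) dvd_trans by blast
    then obtain h where h: "\<And>n. f n = int p * h n" unfolding dvd_def by metis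
    have "m' dvd h n"
    proof (rule less.hyps)
      show "nat \<bar>m'\<bar> < nat \<bar>m\<bar>"
        using 2 p prime_gt_1_nat[of p] by (auto simp: m abs_mult)
      fix n
      have "int p * h (n + 2) = int p * ((2 + J) * h (n + 1) - h n)"
        using prems(1)[of n] unfolding h by (simp add: algebra_simps)
      then show "h (n + 2) = (2 + J) * h (n + 1) - h n" using p0 mult_cancel_left by blast
      show "m' dvd h (n + p ^ k) - h n"
        using prems(2)[of n] p0 unfolding h m by (simp flip: right_diff_distrib)
      show "m' dvd int p ^ l * h n"
        using prems(3)[of n] p0 unfolding h m by (simp add: mult.left_commute[of _ "int p"])
    qed
    then show ?thesis by (simp add: h m)
  next
    case 3
    then have "coprime m (int p)"
      using p by (metis coprime_commute prime_imp_coprime prime_nat_int_transfer)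
    then show ?thesis
      using prems(3)[of n] coprime_dvd_mult_right_iff coprime_power_right_iff by metis
  qed
qed

section \<open>Galois action on projective points\<close>

locale field_automorphism =
  fixes \<sigma> :: "'a::field \<Rightarrow> 'a"
  assumes bij: "bij \<sigma>"
    and add: "\<sigma> (x + y) = \<sigma> x + \<sigma> y"
    and mult: "\<sigma> (x * y) = \<sigma> x * \<sigma> y"
begin

lemma zero [simp]: "\<sigma> 0 = 0"
  using add[of 0 0] by (metis add_0 add_cancel_right_left)

lemma eq_0_iff [simp]: "\<sigma> x = 0 \<longleftrightarrow> x = 0"
  using bij zero by (metis bij_pointE)

lemma one [simp]: "\<sigma> 1 = 1"
  using mult[of 1 1] by simp

lemma sum: "\<sigma> (\<Sum>i\<in>I. f i) = (\<Sum>i\<in>I. \<sigma> (f i))"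
  by (induction I rule: infinite_finite_induct) (simp_all add: add)

lemma prod: "\<sigma> (\<Prod>i\<in>I. f i) = (\<Prod>i\<in>I. \<sigma> (f i))"
  by (induction I rule: infinite_finite_induct) (simp_all add: mult)

lemma power: "\<sigma> (x ^ k) = \<sigma> x ^ k"
  by (induction k) (simp_all add: mult)

lemma peval_comp:
  assumes "\<And>m. m \<in> Poly_Mapping.keys p \<Longrightarrow> \<sigma> (Poly_Mapping.lookup p m) = Poly_Mapping.lookup p m"
  shows "peval p (\<sigma> \<circ> v) = \<sigma> (peval p v)"
  unfolding peval_def by (simp add: sum prod mult power assms)

end

section \<open>Galois automorphisms and homogeneous coordinates\<close>

lemma Gal_UNIV_iff:
  "\<sigma> \<in> carrier (Gal UNIV K) \<longleftrightarrow> field_automorphism \<sigma> \<and> (\<forall>x\<in>K. \<sigma> x = x)"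
  by (auto simp: Gal_def Bij_def field_automorphism_def)

lemma Gal_UNIV_comp:
  assumes "\<sigma> \<in> carrier (Gal UNIV K)" "\<tau> \<in> carrier (Gal UNIV K)"
  shows "\<sigma> \<circ> \<tau> \<in> carrier (Gal UNIV K)"
  using assms by (auto simp: Gal_UNIV_iff field_automorphism_def bij_comp)

lemma Gal_UNIV_id: "id \<in> carrier (Gal UNIV K)"
  by (auto simp: Gal_UNIV_iff field_automorphism_def)

lemma gal_act_comp: "gal_act \<sigma> (gal_act \<tau> x) = gal_act (\<sigma> \<circ> \<tau>) x"
  by (simp add: gal_act_def image_comp comp_def)

lemma gal_act_id: "gal_act id x = x"
  by (simp add: gal_act_def)

lemma gal_act_funpow: "(gal_act \<sigma> ^^ k) x = gal_act (\<sigma> ^^ k) x"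
  by (induction k) (simp_all add: gal_act_id gal_act_comp comp_def flip: id_def)

lemma proj_point_self: "v \<in> proj_point v"
  unfolding proj_point_def by (auto intro!: exI[of _ 1])

lemma proj_point_eqI:
  assumes "w \<in> proj_point v"
  shows "proj_point w = proj_point v"
proof -
  obtain c where c: "c \<noteq> 0" "w = (\<lambda>i. c * v i)"
    using assms by (auto simp: proj_point_def)
  have "\<exists>e. (\<lambda>i. d * v i) = (\<lambda>i. e * (c * v i)) \<and> e \<noteq> 0" if "d \<noteq> 0" for d
    using c(1) that by (intro exI[of _ "d / c"]) auto
  then show ?thesis
    using c by (auto simp: proj_point_def mult.assoc[symmetric])
qed

lemma (in field_automorphism) gal_act_proj_point: "gal_act \<sigma> (proj_point v) = proj_point (\<sigma> \<circ> v)"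
proof
  show "gal_act \<sigma> (proj_point v) \<subseteq> proj_point (\<sigma> \<circ> v)"
    by (auto simp: gal_act_def proj_point_def fun_eq_iff mult) 
  show "proj_point (\<sigma> \<circ> v) \<subseteq> gal_act \<sigma> (proj_point v)"
  proof
    fix w assume "w \<in> proj_point (\<sigma> \<circ> v)"
    then obtain d where d: "d \<noteq> 0" "w = (\<lambda>i. d * \<sigma> (v i))" by (auto simp: proj_point_def)
    obtain c where c: "\<sigma> c = d" using bij by (metis bij_pointE)
    then have "w = \<sigma> \<circ> (\<lambda>i. c * v i)" "c \<noteq> 0" using d by (auto simp: mult)
    then show "w \<in> gal_act \<sigma> (proj_point v)" by (auto simp: gal_act_def proj_point_def)
  qed
qed

lemma proj_spaceE:
  assumes "x \<in> proj_space n"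
  obtains v where "x = proj_point v" "v \<in> x" "\<exists>i. v i \<noteq> 0" "\<And>i. i > n \<Longrightarrow> v i = 0"
  using assms unfolding proj_space_def by (auto intro: proj_point_self)

lemma proj_space_mem:
  assumes "x \<in> proj_space n" "v \<in> x"
  shows "x = proj_point v" "\<And>i. i > n \<Longrightarrow> v i = 0"
proof -
  obtain w where w: "x = proj_point w" "\<And>i. i > n \<Longrightarrow> w i = 0"
    using assms proj_spaceE by metis
  then show "x = proj_point v" using assms(2) proj_point_eqI by blast
  show "v i = 0" if "i > n" for i
    using assms(2) w that by (auto simp: proj_point_def)
qed

section \<open>Galois equivariance of the group law\<close>

lemma abelian_variety_carrier_subset:
  assumes "abelian_variety K n A"
  shows "carrier A \<subseteq> proj_space n"
  using assms unfolding abelian_variety_def proj_closed_def by auto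

text \<open>The forms that define \<open>A\<close> have coefficients in \<open>K\<close>, which
  \<sigma> fixes, so evaluating them commutes with \<sigma> and zeros go to zeros.\<close>

lemma gal_act_mem_abelian_variety:
  assumes A: "abelian_variety K n A" and \<sigma>: "\<sigma> \<in> carrier (Gal UNIV K)" and x: "x \<in> carrier A"
  shows "gal_act \<sigma> x \<in> carrier A"
proof -
  interpret field_automorphism \<sigma> using \<sigma> Gal_UNIV_iff by blast
  have K_fixed: "\<And>x. x \<in> K \<Longrightarrow> \<sigma> x = x" using \<sigma> Gal_UNIV_iff by blast
  obtain S where S: "\<And>p. p \<in> S \<Longrightarrow> \<exists>d. form_over K n d p"
    "carrier A = {x \<in> proj_space n. \<forall>p\<in>S. \<forall>v\<in>x. peval p v = 0}"
    using A unfolding abelian_variety_def proj_closed_def by auto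
  obtain v where v: "x = proj_point v" "v \<in> x" "\<exists>i. v i \<noteq> 0" "\<And>i. i > n \<Longrightarrow> v i = 0"
    using x S(2) proj_spaceE by blast
  have "gal_act \<sigma> x \<in> proj_space n"
    unfolding proj_space_def v(1) gal_act_proj_point
    by (intro imageI) (use v(3,4) in auto)
  moreover have "peval p w = 0" if pS: "p \<in> S" and w: "w \<in> gal_act \<sigma> x" for p w
  proof -
    obtain u where u: "u \<in> x" "w = \<sigma> \<circ> u" using w unfolding gal_act_def by blast
    have "peval p w = \<sigma> (peval p u)"
      unfolding u(2) using S(1)[OF pS] by (intro peval_comp K_fixed) (auto simp: form_over_def)
    then show ?thesis using pS u(1) x S(2) by auto
  qed
  ultimately show ?thesis unfolding S(2) by blast
qed

text \<open>A tuple of biforms over \<open>K\<close> computes the sum at \<open>(x, y)\<close>. Its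
  values at the conjugate vectors are the conjugate values, so it does not vanish there and computes
  the sum of the conjugate points as well.\<close>

lemma gal_act_mult:
  assumes A: "abelian_variety K n A" and \<sigma>: "\<sigma> \<in> carrier (Gal UNIV K)"
    and x: "x \<in> carrier A" and y: "y \<in> carrier A"
  shows "gal_act \<sigma> (x \<otimes>\<^bsub>A\<^esub> y) = gal_act \<sigma> x \<otimes>\<^bsub>A\<^esub> gal_act \<sigma> y"
proof -
  interpret field_automorphism \<sigma> using \<sigma> Gal_UNIV_iff by blast
  have K_fixed: "\<And>x. x \<in> K \<Longrightarrow> \<sigma> x = x" using \<sigma> Gal_UNIV_iff by blast
  have "morphism2 K n (carrier A) n (\<lambda>x y. x \<otimes>\<^bsub>A\<^esub> y)"
    using A unfolding abelian_variety_def by blast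
  then have "\<exists>d e f. (\<forall>i\<le>n. biform_over K n d e (f i)) \<and>
     (\<forall>v\<in>x. \<forall>w\<in>y. \<exists>i\<le>n. peval (f i) (case_sum v w) \<noteq> 0) \<and>
     (\<forall>x'\<in>carrier A. \<forall>y'\<in>carrier A. \<forall>v\<in>x'. \<forall>w\<in>y'. (\<exists>i\<le>n. peval (f i) (case_sum v w) \<noteq> 0) \<longrightarrow>
        x' \<otimes>\<^bsub>A\<^esub> y' = proj_point (\<lambda>i. if i \<le> n then peval (f i) (case_sum v w) else 0))"
    using x y unfolding morphism2_def by (elim ballE) auto
  then obtain d e f where f: "\<forall>i\<le>n. biform_over K n d e (f i)"
    and nz: "\<forall>v\<in>x. \<forall>w\<in>y. \<exists>i\<le>n. peval (f i) (case_sum v w) \<noteq> 0"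
    and "\<forall>x'\<in>carrier A. \<forall>y'\<in>carrier A. \<forall>v\<in>x'. \<forall>w\<in>y'. (\<exists>i\<le>n. peval (f i) (case_sum v w) \<noteq> 0) \<longrightarrow>
        x' \<otimes>\<^bsub>A\<^esub> y' = proj_point (\<lambda>i. if i \<le> n then peval (f i) (case_sum v w) else 0)"
    by (elim exE conjE)
  then have mult_eq: "x' \<otimes>\<^bsub>A\<^esub> y' = proj_point (\<lambda>i. if i \<le> n then peval (f i) (case_sum v w) else 0)"
    if "x' \<in> carrier A" "y' \<in> carrier A" "v \<in> x'" "w \<in> y'"
      "\<exists>i\<le>n. peval (f i) (case_sum v w) \<noteq> 0" for x' y' v w
    using that by blast
  obtain v w where vw: "v \<in> x" "w \<in> y"
    using x y abelian_variety_carrier_subset[OF A] by (meson proj_spaceE subsetD)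
  have case_sum_comp: "case_sum (\<sigma> \<circ> v) (\<sigma> \<circ> w) = \<sigma> \<circ> case_sum v w"
    by (auto simp: fun_eq_iff split: sum.split)
  have conj: "peval (f i) (case_sum (\<sigma> \<circ> v) (\<sigma> \<circ> w)) = \<sigma> (peval (f i) (case_sum v w))" if "i \<le> n" for i
    unfolding case_sum_comp using f that by (intro peval_comp K_fixed) (auto simp: biform_over_def)
  have "gal_act \<sigma> x \<otimes>\<^bsub>A\<^esub> gal_act \<sigma> y
      = proj_point (\<lambda>i. if i \<le> n then peval (f i) (case_sum (\<sigma> \<circ> v) (\<sigma> \<circ> w)) else 0)"
  proof (rule mult_eq)
    show "\<exists>i\<le>n. peval (f i) (case_sum (\<sigma> \<circ> v) (\<sigma> \<circ> w)) \<noteq> 0"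
      using nz vw conj by fastforce
  qed (use vw gal_act_mem_abelian_variety[OF A \<sigma>] x y in \<open>auto simp: gal_act_def\<close>)
  also have "(\<lambda>i. if i \<le> n then peval (f i) (case_sum (\<sigma> \<circ> v) (\<sigma> \<circ> w)) else 0)
      = \<sigma> \<circ> (\<lambda>i. if i \<le> n then peval (f i) (case_sum v w) else 0)"
    by (auto simp: conj)
  also have "proj_point \<dots> = gal_act \<sigma> (x \<otimes>\<^bsub>A\<^esub> y)"
    using mult_eq[OF x y vw] nz vw gal_act_proj_point by simp
  finally show ?thesis
    by simp
qed

lemma gal_act_hom:
  assumes "abelian_variety K n A" and "\<sigma> \<in> carrier (Gal UNIV K)"
  shows "gal_act \<sigma> \<in> hom A A"
  using assms by (intro homI) (auto simp: gal_act_mem_abelian_variety gal_act_mult)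

section \<open>Pro-p extensions\<close>

lemma Kbar_simps [simp]:
  "carrier Kbar = UNIV" "x \<otimes>\<^bsub>Kbar\<^esub> y = x * y" "x \<oplus>\<^bsub>Kbar\<^esub> y = x + y" "\<zero>\<^bsub>Kbar\<^esub> = 0" "\<one>\<^bsub>Kbar\<^esub> = 1"
  by (simp_all add: ring_of_type_algebra_def)

lemma Kbar_nat_pow [simp]: "x [^]\<^bsub>Kbar\<^esub> (k::nat) = x ^ k" for x :: "'a::field"
  by (induction k) (simp_all add: nat_pow_def)

lemma subfield_KbarD:
  assumes "subfield L (Kbar :: 'a::field ring)"
  shows "0 \<in> L" "1 \<in> L" "x \<in> L \<Longrightarrow> y \<in> L \<Longrightarrow> x + y \<in> L" "x \<in> L \<Longrightarrow> y \<in> L \<Longrightarrow> x * y \<in> L"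
    "x \<in> L \<Longrightarrow> x ^ k \<in> L"
proof -
  note sr = subringE[OF subfieldE(1)[OF assms], simplified]
  show "0 \<in> L" "1 \<in> L" "x \<in> L \<Longrightarrow> y \<in> L \<Longrightarrow> x + y \<in> L" "x \<in> L \<Longrightarrow> y \<in> L \<Longrightarrow> x * y \<in> L"
    using sr by auto
  show "x \<in> L \<Longrightarrow> x ^ k \<in> L"
    by (induction k) (use sr in auto)
qed

lemma carrier_Gal_iff:
  "\<sigma> \<in> carrier (Gal L K) \<longleftrightarrow> \<sigma> \<in> extensional L \<and> bij_betw \<sigma> L L \<and>
     (\<forall>x\<in>L. \<forall>y\<in>L. \<sigma> (x + y) = \<sigma> x + \<sigma> y \<and> \<sigma> (x * y) = \<sigma> x * \<sigma> y) \<and> (\<forall>x\<in>K. \<sigma> x = x)"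
  by (auto simp: Gal_def Bij_def)

text \<open>Here \<sigma> respects sums and products of elements of \<open>L\<close> only, so
  membership of the value in \<open>L\<close> is proved along with the equation.\<close>

lemma Gal_eval:
  fixes L :: "'a::field set"
  assumes L: "subfield L Kbar" "K \<subseteq> L" and \<sigma>: "\<sigma> \<in> carrier (Gal L K)"
    and p: "set p \<subseteq> K" and x: "x \<in> L"
  shows "ring.eval Kbar p x \<in> L" "\<sigma> (ring.eval Kbar p x) = ring.eval Kbar p (\<sigma> x)"
proof -
  interpret R: field "Kbar :: 'a ring" by (rule field_from_type_algebra)
  note Lc = subfield_KbarD[OF L(1)]
  have add: "\<And>x y. x \<in> L \<Longrightarrow> y \<in> L \<Longrightarrow> \<sigma> (x + y) = \<sigma> x + \<sigma> y"
    and mult: "\<And>x y. x \<in> L \<Longrightarrow> y \<in> L \<Longrightarrow> \<sigma> (x * y) = \<sigma> x * \<sigma> y"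
    and K_fixed: "\<And>x. x \<in> K \<Longrightarrow> \<sigma> x = x"
    and bij: "bij_betw \<sigma> L L"
    using \<sigma> unfolding carrier_Gal_iff by blast+
  have zero: "\<sigma> 0 = 0"
    using add[OF Lc(1) Lc(1)] by (metis add_0 add_cancel_right_left)
  have one: "\<sigma> 1 = 1"
    using mult[OF Lc(2) Lc(2)] bij_betw_imp_inj_on[OF bij] Lc(1,2) zero
    by (metis inj_on_def mult_cancel_right2 zero_neq_one mult_1)
  have power: "\<sigma> (x ^ k) = \<sigma> x ^ k" for k
    by (induction k) (use x Lc in \<open>simp_all add: one mult\<close>)
  have "ring.eval Kbar p x \<in> L \<and> \<sigma> (ring.eval Kbar p x) = ring.eval Kbar p (\<sigma> x)"
    using p
  proof (induction p)
    case (Cons a p)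
    then have a: "a \<in> L" "\<sigma> a = a" and IH: "R.eval p x \<in> L" "\<sigma> (R.eval p x) = R.eval p (\<sigma> x)"
      using L(2) K_fixed by auto
    then show ?case
      using x Lc by (simp add: add mult power)
  qed (simp add: zero Lc)
  then show "ring.eval Kbar p x \<in> L" "\<sigma> (ring.eval Kbar p x) = ring.eval Kbar p (\<sigma> x)"
    by blast+
qed

lemma Gal_is_root:
  fixes L :: "'a::field set"
  assumes L: "subfield L Kbar" "K \<subseteq> L" and \<sigma>: "\<sigma> \<in> carrier (Gal L K)"
    and p: "p \<in> carrier (univ_poly Kbar K)" and x: "x \<in> L" "ring.is_root Kbar p x"
  shows "ring.is_root Kbar p (\<sigma> x)"
proof -
  interpret R: field "Kbar :: 'a ring" by (rule field_from_type_algebra)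
  have root: "R.eval p x = 0" "p \<noteq> []" using x(2) by (auto simp: R.is_root_def)
  have K: "set p \<subseteq> K" using p by (auto simp: univ_poly_def polynomial_def)
  have "0 \<in> L" using subfield_KbarD[OF L(1)] by blast
  then have "\<sigma> 0 + \<sigma> 0 = \<sigma> 0"
    using \<sigma> unfolding carrier_Gal_iff by (metis add_0)
  then have "\<sigma> 0 = 0" by (metis add_cancel_right_right)
  then have "R.eval p (\<sigma> x) = 0"
    using Gal_eval(2)[OF L \<sigma> K x(1)] root(1) by simp
  then show ?thesis using root(2) by (simp add: R.is_root_def)
qed

section \<open>Conjugates and finite Galois-stable sets\<close>

text \<open>\<open>S\<close> is the set of roots of the minimal polynomial of \<open>x\<close> over
  \<open>K\<close>: finite, inside \<open>L\<close> by normality, and preserved by automorphisms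
  that fix the coefficients.\<close>

lemma finite_stable_conjugates:
  fixes K :: "'a::{alg_closed_field, field_char_0} set"
  assumes K: "type_is_algebraic_closure K" and L: "galois_extension L K" and x: "x \<in> L"
  shows "\<exists>S. finite S \<and> x \<in> S \<and> S \<subseteq> L \<and>
    (\<forall>\<sigma>\<in>carrier (Gal L K) \<union> carrier (Gal UNIV K). \<sigma> ` S \<subseteq> S)"
proof -
  interpret R: field "Kbar :: 'a ring" by (rule field_from_type_algebra)
  have sub: "subfield K (Kbar :: 'a ring)" and alg: "(R.algebraic over K) x"
    using K unfolding type_is_algebraic_closure_def by auto
  have subL: "subfield L (Kbar :: 'a ring)" and KL: "K \<subseteq> L"
    using L unfolding galois_extension_def by auto
  let ?p = "R.Irr K x"
  let ?S = "{y. R.is_root ?p y}"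
  have xc: "x \<in> carrier Kbar" by simp
  note Irr = R.IrrE[OF sub xc alg]
  have ne: "?p \<noteq> []"
    using Irr(2) by (rule R.pirreducibleE(1)[OF subfieldE(1)[OF sub] Irr(1)])
  have root: "R.is_root ?p x"
    using Irr(4) ne by (simp add: R.is_root_def)
  have "\<forall>f\<in>carrier (univ_poly Kbar K). ring_irreducible\<^bsub>univ_poly Kbar K\<^esub> f \<longrightarrow>
      (\<exists>x\<in>L. R.is_root f x) \<longrightarrow> {x. R.is_root f x} \<subseteq> L"
    using L unfolding galois_extension_def by (elim conjE)
  from this[THEN bspec, OF Irr(1), THEN mp, OF Irr(2), THEN mp, OF bexI[where P = "\<lambda>x. R.is_root ?p x", OF root x]]
  have SL: "?S \<subseteq> L" .
  have "?p \<in> carrier (univ_poly Kbar (UNIV :: 'a set))"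
    using Irr(1) by (auto simp: univ_poly_def polynomial_def)
  then have fin: "finite ?S"
    using R.finite_number_of_roots by simp
  have subU: "subfield UNIV (Kbar :: 'a ring)"
    using R.carrier_is_subfield by simp
  have "\<sigma> ` ?S \<subseteq> ?S" if "\<sigma> \<in> carrier (Gal L K)" for \<sigma>
    using Gal_is_root[OF subL KL that Irr(1)] SL by auto
  moreover have "\<sigma> ` ?S \<subseteq> ?S" if "\<sigma> \<in> carrier (Gal UNIV K)" for \<sigma>
    using Gal_is_root[OF subU _ that Irr(1)] by auto
  ultimately show ?thesis
    using fin root SL by (intro exI[of _ ?S]) blast
qed

text \<open>A union of sets of conjugates. Stability under the Galois group is what later makes the
  pointwise stabilizer of \<open>S\<close> normal.\<close>

lemma finite_stable_superset:
  fixes K :: "'a::{alg_closed_field, field_char_0} set"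
  assumes K: "type_is_algebraic_closure K" and L: "galois_extension L K"
    and "finite F" "F \<subseteq> L"
  shows "\<exists>S. finite S \<and> F \<subseteq> S \<and> S \<subseteq> L \<and> (\<forall>\<sigma>\<in>carrier (Gal L K). \<sigma> ` S \<subseteq> S)"
  using assms(3,4)
proof (induction F rule: finite_induct)
  case (insert x F)
  then have xL: "x \<in> L" and "F \<subseteq> L" by auto
  from insert.IH[OF \<open>F \<subseteq> L\<close>] obtain S
    where S: "finite S" "F \<subseteq> S" "S \<subseteq> L" "\<forall>\<sigma>\<in>carrier (Gal L K). \<sigma> ` S \<subseteq> S"
    by (elim exE conjE)
  from finite_stable_conjugates[OF K L xL] obtain T
    where T: "finite T" "x \<in> T" "T \<subseteq> L"
      "\<forall>\<sigma>\<in>carrier (Gal L K) \<union> carrier (Gal UNIV K). \<sigma> ` T \<subseteq> T"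
    by (elim exE conjE)
  have stable: "\<sigma> ` (S \<union> T) \<subseteq> S \<union> T" if "\<sigma> \<in> carrier (Gal L K)" for \<sigma>
    using S(4) T(4) that unfolding image_Un by blast
  show ?case
    using S(1-3) T(1-3) stable by (intro exI[of _ "S \<union> T"]) blast
qed (auto intro!: exI[of _ "{}"])

text \<open>The point is that \<sigma> maps \<open>L\<close> onto itself: every element of
  \<open>L\<close> lies in a finite stable subset of \<open>L\<close>, and an injective self-map of
  a finite set is onto.\<close>

lemma restrict_mem_Gal:
  fixes K :: "'a::{alg_closed_field, field_char_0} set"
  assumes K: "type_is_algebraic_closure K" and L: "galois_extension L K"
    and \<sigma>: "\<sigma> \<in> carrier (Gal UNIV K)"
  shows "restrict \<sigma> L \<in> carrier (Gal L K)"
proof -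
  interpret field_automorphism \<sigma> using \<sigma> Gal_UNIV_iff by blast
  have subL: "subfield L (Kbar :: 'a ring)" and KL: "K \<subseteq> L"
    using L unfolding galois_extension_def by auto
  have inj: "inj_on \<sigma> S" for S
    using bij by (meson bij_is_inj inj_on_subset subset_UNIV)
  have "\<sigma> x \<in> L \<and> x \<in> \<sigma> ` L" if x: "x \<in> L" for x
  proof -
    from finite_stable_conjugates[OF K L x] obtain S
      where S: "finite S" "x \<in> S" "S \<subseteq> L"
        and "\<forall>\<sigma>\<in>carrier (Gal L K) \<union> carrier (Gal UNIV K). \<sigma> ` S \<subseteq> S"
      by (elim exE conjE)
    then have "\<sigma> ` S \<subseteq> S" using \<sigma> by blast
    with S(1) have "\<sigma> ` S = S" using inj by (simp add: endo_inj_surj)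
    then show ?thesis using S by blast
  qed
  then have "bij_betw \<sigma> L L"
    using inj by (auto simp: bij_betw_def)
  moreover have "\<forall>x\<in>K. \<sigma> x = x"
    using \<sigma> Gal_UNIV_iff by blast
  ultimately show ?thesis
    using subfield_KbarD[OF subL] subsetD[OF KL]
    unfolding carrier_Gal_iff by (simp add: add mult bij_betw_restrict_eq)
qed

section \<open>The Galois group of \<open>L\<close> over \<open>K\<close> and its pointwise
  stabilizers\<close>

lemma Gal_group:
  assumes "subfield L (Kbar :: 'a::field ring)" and "K \<subseteq> L"
  shows "group (Gal L K)"
proof -
  note Lc = subfield_KbarD[OF assms(1)]
  have "subgroup (carrier (Gal L K)) (BijGroup L)"
  proof (rule group.subgroupI[OF group_BijGroup])
    show "carrier (Gal L K) \<subseteq> carrier (BijGroup L)"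
      by (auto simp: Gal_def BijGroup_def)
    have "(\<lambda>x\<in>L. x) \<in> carrier (Gal L K)"
      using Lc assms(2) by (auto simp: Gal_def id_Bij)
    then show "carrier (Gal L K) \<noteq> {}" by blast
  next
    fix \<sigma> assume \<sigma>: "\<sigma> \<in> carrier (Gal L K)"
    then have B: "\<sigma> \<in> Bij L" by (simp add: Gal_def)
    have inj: "inj_on \<sigma> L" using B by (simp add: Bij_def bij_betw_def)
    have "inv_into L \<sigma> x = x" if "x \<in> K" for x
      using that assms(2) \<sigma> inj inv_into_f_f[of \<sigma> L x] by (auto simp: Gal_def)
    moreover have "inv_into L \<sigma> (x + y) = inv_into L \<sigma> x + inv_into L \<sigma> y" if "x \<in> L" "y \<in> L" for x y
      using B Lc that \<sigma> by (intro Bij_inv_into_lemma) (auto simp: Gal_def)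
    moreover have "inv_into L \<sigma> (x * y) = inv_into L \<sigma> x * inv_into L \<sigma> y" if "x \<in> L" "y \<in> L" for x y
      using B Lc that \<sigma> by (intro Bij_inv_into_lemma) (auto simp: Gal_def)
    ultimately show "inv\<^bsub>BijGroup L\<^esub> \<sigma> \<in> carrier (Gal L K)"
      using B Lc assms(2) restrict_inv_into_Bij[OF B] by (auto simp: inv_BijGroup Gal_def subset_iff)
  next
    fix \<sigma> \<tau> assume "\<sigma> \<in> carrier (Gal L K)" "\<tau> \<in> carrier (Gal L K)"
    then show "\<sigma> \<otimes>\<^bsub>BijGroup L\<^esub> \<tau> \<in> carrier (Gal L K)"
      using Lc assms(2) Bij_imp_funcset[of \<sigma> L] Bij_imp_funcset[of \<tau> L]
      by (auto simp: Gal_def BijGroup_def compose_Bij compose_eq subset_iff Pi_iff)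
  qed
  then have "group (BijGroup L \<lparr>carrier := carrier (Gal L K)\<rparr>)"
    by (rule subgroup.subgroup_is_group[OF _ group_BijGroup])
  then show ?thesis by (simp add: Gal_def)
qed

lemma Gal_mult: "\<sigma> \<in> carrier (Gal L K) \<Longrightarrow> \<tau> \<in> carrier (Gal L K) \<Longrightarrow> \<sigma> \<otimes>\<^bsub>Gal L K\<^esub> \<tau> = compose L \<sigma> \<tau>"
  by (simp add: Gal_def BijGroup_def)

lemma Gal_one: "\<one>\<^bsub>Gal L K\<^esub> = (\<lambda>x\<in>L. x)"
  by (simp add: Gal_def BijGroup_def)

lemma Gal_pow_apply:
  assumes "subfield L (Kbar :: 'a::field ring)" and "K \<subseteq> L" and \<sigma>: "\<sigma> \<in> carrier (Gal L K)" and "x \<in> L"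
  shows "(\<sigma> [^]\<^bsub>Gal L K\<^esub> k) x = (\<sigma> ^^ k) x"
  using \<open>x \<in> L\<close>
proof (induction k arbitrary: x)
  case (Suc k)
  interpret group "Gal L K" by (rule Gal_group[OF assms(1,2)])
  have "\<sigma> x \<in> L" using \<sigma> Suc.prems by (auto simp: carrier_Gal_iff bij_betw_def)
  then show ?case
    using Suc \<sigma> by (simp add: Gal_mult compose_eq funpow_swap1)
qed (simp add: Gal_one)

text \<open>Conjugation preserves the stabilizer because the inverse of \<sigma> sends a point of
  \<open>S\<close> to a point of \<open>S\<close>, which \<tau> fixes.\<close>

lemma pointwise_stabilizer_normal:
  assumes L: "subfield L (Kbar :: 'a::field ring)" "K \<subseteq> L"
    and S: "S \<subseteq> L" "\<And>\<sigma>. \<sigma> \<in> carrier (Gal L K) \<Longrightarrow> \<sigma> ` S \<subseteq> S"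
  shows "{\<sigma> \<in> carrier (Gal L K). \<forall>x\<in>S. \<sigma> x = x} \<lhd> Gal L K"
proof -
  interpret group "Gal L K" by (rule Gal_group[OF L])
  let ?N = "{\<sigma> \<in> carrier (Gal L K). \<forall>x\<in>S. \<sigma> x = x}"
  have mult: "(\<sigma> \<otimes>\<^bsub>Gal L K\<^esub> \<tau>) x = \<sigma> (\<tau> x)" if "\<sigma> \<in> carrier (Gal L K)" "\<tau> \<in> carrier (Gal L K)" "x \<in> S" for \<sigma> \<tau> x
    using that S(1) by (auto simp: Gal_mult compose_eq)
  have inv1: "(inv\<^bsub>Gal L K\<^esub> \<sigma>) (\<sigma> x) = x" if "\<sigma> \<in> carrier (Gal L K)" "x \<in> S" for \<sigma> x
    using mult[of "inv\<^bsub>Gal L K\<^esub> \<sigma>" \<sigma> x] that S(1) by (auto simp: Gal_one)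
  have inv2: "\<sigma> ((inv\<^bsub>Gal L K\<^esub> \<sigma>) x) = x" if "\<sigma> \<in> carrier (Gal L K)" "x \<in> S" for \<sigma> x
    using mult[of \<sigma> "inv\<^bsub>Gal L K\<^esub> \<sigma>" x] that S(1) by (auto simp: Gal_one)
  show ?thesis
  proof (rule normal_invI)
    show "subgroup ?N (Gal L K)"
    proof (rule subgroupI)
      show "?N \<noteq> {}"
        using one_closed S(1) by (auto simp: Gal_one intro!: exI[of _ "\<lambda>x\<in>L. x"])
      show "inv\<^bsub>Gal L K\<^esub> \<sigma> \<in> ?N" if "\<sigma> \<in> ?N" for \<sigma>
      proof -
        have "(inv\<^bsub>Gal L K\<^esub> \<sigma>) x = x" if "x \<in> S" for x
          using inv1[of \<sigma> x] \<open>\<sigma> \<in> ?N\<close> that by auto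
        then show ?thesis using that by auto
      qed
      show "\<sigma> \<otimes>\<^bsub>Gal L K\<^esub> \<tau> \<in> ?N" if "\<sigma> \<in> ?N" "\<tau> \<in> ?N" for \<sigma> \<tau>
        using that mult by auto
    qed auto
    fix \<sigma> \<tau> assume \<sigma>: "\<sigma> \<in> carrier (Gal L K)" and \<tau>: "\<tau> \<in> ?N"
    have "(\<sigma> \<otimes>\<^bsub>Gal L K\<^esub> \<tau> \<otimes>\<^bsub>Gal L K\<^esub> inv\<^bsub>Gal L K\<^esub> \<sigma>) x = x" if "x \<in> S" for x
    proof -
      have "(inv\<^bsub>Gal L K\<^esub> \<sigma>) x \<in> S"
        using S(2)[of "inv\<^bsub>Gal L K\<^esub> \<sigma>"] \<sigma> that by auto
      then show ?thesis
        using \<sigma> \<tau> that by (simp add: mult inv2)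
    qed
    then show "\<sigma> \<otimes>\<^bsub>Gal L K\<^esub> \<tau> \<otimes>\<^bsub>Gal L K\<^esub> inv\<^bsub>Gal L K\<^esub> \<sigma> \<in> ?N"
      using \<sigma> \<tau> by auto
  qed
qed

text \<open>The pointwise stabilizer of a finite stable superset of \<open>F\<close> is open and
  normal, hence of index \<open>p ^ k\<close>, and the order of the quotient kills each of its
  elements. The same \<open>k\<close> serves all \<sigma>.\<close>

lemma pro_p_Gal_fixes_finite:
  fixes K :: "'a::{alg_closed_field, field_char_0} set"
  assumes K: "type_is_algebraic_closure K" and L: "galois_extension L K"
    and p: "pro_p_Gal p L K" and F: "finite F" "F \<subseteq> L"
  shows "\<exists>k. \<forall>\<sigma>\<in>carrier (Gal UNIV K). \<forall>x\<in>F. (\<sigma> ^^ (p ^ k)) x = x"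
proof -
  have subL: "subfield L (Kbar :: 'a ring)" and KL: "K \<subseteq> L"
    using L unfolding galois_extension_def by auto
  from finite_stable_superset[OF K L F] obtain S
    where S: "finite S" "F \<subseteq> S" "S \<subseteq> L" and stable: "\<forall>\<sigma>\<in>carrier (Gal L K). \<sigma> ` S \<subseteq> S"
    by (elim exE conjE)
  define N where "N = {\<sigma> \<in> carrier (Gal L K). \<forall>x\<in>S. \<sigma> x = x}"
  have N: "N \<lhd> Gal L K"
    unfolding N_def by (rule pointwise_stabilizer_normal[OF subL KL S(3) bspec[OF stable]])
  \<comment> \<open>\<open>S\<close> itself witnesses openness: whatever agrees on \<open>S\<close>
    with an element of \<open>N\<close> fixes \<open>S\<close> pointwise.\<close>
  have "krull_open L K N"
    unfolding krull_open_def N_def by (intro conjI ballI exI[of _ S]) (use S in auto)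
  then obtain k where k: "card (rcosets\<^bsub>Gal L K\<^esub> N) = p ^ k"
    using p N unfolding pro_p_Gal_def by blast
  interpret N: normal N "Gal L K" by (rule N)
  interpret Q: group "Gal L K Mod N" by (rule N.factorgroup_is_group)
  have "(\<sigma> ^^ (p ^ k)) x = x" if \<sigma>: "\<sigma> \<in> carrier (Gal UNIV K)" and x: "x \<in> F" for \<sigma> x
  proof -
    let ?\<rho> = "restrict \<sigma> L"
    have \<rho>: "?\<rho> \<in> carrier (Gal L K)"
      by (rule restrict_mem_Gal[OF K L \<sigma>])
    have "Coset.order (Gal L K Mod N) = p ^ k"
      using k by (simp add: Coset.order_def FactGroup_def)
    moreover have "N #>\<^bsub>Gal L K\<^esub> ?\<rho> \<in> carrier (Gal L K Mod N)"
      using \<rho> by (auto simp: FactGroup_def RCOSETS_def)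
    ultimately have "(N #>\<^bsub>Gal L K\<^esub> ?\<rho>) [^]\<^bsub>Gal L K Mod N\<^esub> (p ^ k) = N"
      using Q.pow_order_eq_1[of "N #>\<^bsub>Gal L K\<^esub> ?\<rho>"] by (simp add: FactGroup_def)
    then have "N #>\<^bsub>Gal L K\<^esub> (?\<rho> [^]\<^bsub>Gal L K\<^esub> (p ^ k)) = N"
      using N.FactGroup_pow[OF \<rho>] by simp
    then have "?\<rho> [^]\<^bsub>Gal L K\<^esub> (p ^ k) \<in> N"
      using N.rcos_self[of "?\<rho> [^]\<^bsub>Gal L K\<^esub> (p ^ k)"] \<rho> N.subgroup_axioms by auto
    moreover have xS: "x \<in> S" and xL: "x \<in> L"
      using x S(2,3) by blast+
    ultimately have "(?\<rho> [^]\<^bsub>Gal L K\<^esub> (p ^ k)) x = x"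
      unfolding N_def by blast
    then have fixed: "(?\<rho> ^^ (p ^ k)) x = x"
      unfolding Gal_pow_apply[OF subL KL \<rho> xL] .
    have \<sigma>L: "\<sigma> y \<in> L" if "y \<in> L" for y
    proof -
      have "bij_betw ?\<rho> L L" using \<rho> unfolding carrier_Gal_iff by blast
      from bij_betw_apply[OF this that] show ?thesis using that by simp
    qed
    \<comment> \<open>Iterates of the restriction agree with those of \<sigma>, since \<sigma> does
      not leave \<open>L\<close>.\<close>
    have "(?\<rho> ^^ j) x = (\<sigma> ^^ j) x \<and> (\<sigma> ^^ j) x \<in> L" for j
    proof (induction j)
      case (Suc j)
      then show ?case using \<sigma>L[of "(\<sigma> ^^ j) x"] by simp
    qed (simp add: xL)
    then show ?thesis using fixed by metis
  qed
  then show ?thesis by blast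
qed

text \<open>An \<open>L\<close>-rational point has a coordinate vector over \<open>L\<close> with
  finitely many values, being 0 beyond index \<open>n\<close>. An automorphism that fixes these
  values fixes the point.\<close>

lemma pro_p_Gal_fixes_rational_point:
  fixes K :: "'a::{alg_closed_field, field_char_0} set"
  assumes K: "type_is_algebraic_closure K" and L: "galois_extension L K"
    and p: "pro_p_Gal p L K" and A: "abelian_variety K n A" and x: "x \<in> rational_points L A"
  shows "\<exists>k. \<forall>\<sigma>\<in>carrier (Gal UNIV K). (gal_act \<sigma> ^^ (p ^ k)) x = x"
proof -
  obtain v where v: "v \<in> x" "range v \<subseteq> L" and xA: "x \<in> carrier A"
    using x unfolding rational_points_def by blast
  then have xn: "x \<in> proj_space n"
    using abelian_variety_carrier_subset[OF A] by blast
  have "range v \<subseteq> insert 0 (v ` {..n})"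
  proof (rule image_subsetI)
    fix i
    show "v i \<in> insert 0 (v ` {..n})"
      using proj_space_mem(2)[OF xn v(1), of i] by (cases "i \<le> n") auto
  qed
  then have "finite (range v)"
    by (rule finite_subset) simp
  from pro_p_Gal_fixes_finite[OF K L p this v(2)]
  obtain k where k: "\<forall>\<sigma>\<in>carrier (Gal UNIV K). \<forall>y\<in>range v. (\<sigma> ^^ (p ^ k)) y = y" ..
  have "(gal_act \<sigma> ^^ (p ^ k)) x = x" if \<sigma>: "\<sigma> \<in> carrier (Gal UNIV K)" for \<sigma>
  proof -
    have "\<sigma> ^^ j \<in> carrier (Gal UNIV K)" for j
    proof (induction j)
      case (Suc j)
      then show ?case using Gal_UNIV_comp[OF \<sigma> Suc.IH] by (simp only: funpow.simps)
    qed (simp only: funpow.simps Gal_UNIV_id)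
    then interpret field_automorphism "\<sigma> ^^ (p ^ k)" using Gal_UNIV_iff by blast
    have "(\<sigma> ^^ (p ^ k)) \<circ> v = v"
      using bspec[OF k \<sigma>] by (simp add: fun_eq_iff)
    then show ?thesis
      unfolding gal_act_funpow proj_space_mem(1)[OF xn v(1)] gal_act_proj_point by simp
  qed
  then show ?thesis by blast
qed

section \<open>Coordinates on the Tate module\<close>

lemma residue_of_nat: "m > 0 \<Longrightarrow> residue (of_nat k) m = int k mod int m"
  by (induction k) (simp_all add: zero_zhat.rep_eq one_zhat.rep_eq plus_zhat.rep_eq mod_simps add.commute)

lemma residue_of_int: "m > 0 \<Longrightarrow> residue (of_int k) m = k mod int m"
  by (cases k rule: int_cases2) (simp_all add: residue_of_nat uminus_zhat.rep_eq mod_simps)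

text \<open>Coordinates are integers rather than residues, so that matrices act on them by integer
  formulas; at level \<open>m\<close> only their classes modulo \<open>m\<close> matter.\<close>

definition basis_comb :: "('b, 'c) monoid_scheme \<Rightarrow> nat \<Rightarrow> (nat \<Rightarrow> nat \<Rightarrow> 'b) \<Rightarrow> nat \<Rightarrow> (nat \<Rightarrow> int) \<Rightarrow> 'b" where
  "basis_comb A r b m c = (\<Otimes>\<^bsub>A\<^esub>i\<in>{..<r}. b i m [^]\<^bsub>A\<^esub> c i)"

locale tate_basis_group = comm_group A for A (structure) +
  fixes r :: nat and b
  assumes basis: "tate_basis A r b"
begin

abbreviation comb :: "nat \<Rightarrow> (nat \<Rightarrow> int) \<Rightarrow> 'a" where
  "comb \<equiv> basis_comb A r b"

lemma tate_moduleD: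
  assumes "t \<in> carrier (tate_module A)"
  shows "t 0 = \<one>" "t m \<in> carrier A" "t m [^] m = \<one>" "0 < n \<Longrightarrow> m dvd n \<Longrightarrow> t n [^] (n div m) = t m"
  using assms by (cases "m = 0"; auto simp: tate_module_def mtorsion_def)+

lemma b_mem_tate_module: "i < r \<Longrightarrow> b i \<in> carrier (tate_module A)"
  using basis by (auto simp: tate_basis_def)

lemma b_closed [simp]: "i < r \<Longrightarrow> b i m \<in> carrier A"
  using tate_moduleD(2) b_mem_tate_module by blast

lemma comb_closed [simp]: "comb m c \<in> carrier A"
  unfolding basis_comb_def by (intro finprod_closed) auto

lemma b_pow_mod: "i < r \<Longrightarrow> b i m [^] (k mod int m) = b i m [^] k"
proof -
  assume i: "i < r"
  have "b i m [^] (int m) = \<one>"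
    using tate_moduleD(3)[OF b_mem_tate_module[OF i]] by (simp add: int_pow_int)
  then have "b i m [^] (int m * (k div int m)) = \<one>"
    using i by (metis b_closed int_pow_one int_pow_pow)
  then show ?thesis
    using i int_pow_mult[of "b i m" "int m * (k div int m)" "k mod int m"] by simp
qed

lemma comb_cong:
  assumes "\<And>i. i < r \<Longrightarrow> c i mod int m = d i mod int m"
  shows "comb m c = comb m d"
  unfolding basis_comb_def
proof (rule finprod_cong')
  fix i assume "i \<in> {..<r}"
  then show "b i m [^] c i = b i m [^] d i"
    using assms[of i] b_pow_mod[of i m "c i"] b_pow_mod[of i m "d i"] by simp
qed auto

lemma comb_0 [simp]: "comb 0 c = \<one>"
proof -
  have "b i 0 = \<one>" if "i < r" for i
    using tate_moduleD(1)[OF b_mem_tate_module[OF that]] .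
  then show ?thesis
    unfolding basis_comb_def by (intro finprod_one_eqI) simp
qed

lemma comb_zero [simp]: "comb m (\<lambda>i. 0) = \<one>"
  unfolding basis_comb_def by simp

lemma comb_add: "comb m (\<lambda>i. c i + d i) = comb m c \<otimes> comb m d"
proof -
  have "comb m (\<lambda>i. c i + d i) = (\<Otimes>i\<in>{..<r}. b i m [^] c i \<otimes> b i m [^] d i)"
    unfolding basis_comb_def by (intro finprod_cong') (auto simp: int_pow_mult)
  then show ?thesis
    unfolding basis_comb_def by (simp add: Pi_iff)
qed

lemma comb_scale_nat: "comb m (\<lambda>i. int k * c i) = comb m c [^] k"
  by (induction k) (simp_all add: distrib_right comb_add m_comm)

lemma comb_scale: "comb m (\<lambda>i. k * c i) = comb m c [^] k"
proof (cases "k \<ge> 0")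
  case True
  then show ?thesis
    using comb_scale_nat[of m "nat k" c] by (simp flip: int_pow_int)
next
  case False
  have "comb m (\<lambda>i. k * c i) \<otimes> comb m c [^] nat (- k) = \<one>"
    unfolding comb_scale_nat[symmetric] comb_add[symmetric] using False by simp
  then have "comb m (\<lambda>i. k * c i) = inv (comb m c [^] nat (- k))"
    by (intro inv_equality[symmetric]) auto
  then show ?thesis
    using False int_pow_neg_int[of "comb m c" "nat (- k)"] by simp
qed

lemma comb_unit: "j < r \<Longrightarrow> comb m (\<lambda>i. if i = j then 1 else 0) = b j m"
proof -
  assume j: "j < r"
  have "comb m (\<lambda>i. if i = j then 1 else 0) = (\<Otimes>i\<in>{..<r}. if j = i then b i m else \<one>)"
    unfolding basis_comb_def using j by (intro finprod_cong') auto
  then show ?thesis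
    using finprod_singleton[of j "{..<r}" "\<lambda>i. b i m"] j by (simp add: Pi_iff)
qed

lemma comb_sum:
  "finite J \<Longrightarrow> comb m (\<lambda>i. \<Sum>j\<in>J. F j i) = (\<Otimes>j\<in>J. comb m (F j))"
  by (induction J rule: finite_induct) (simp_all add: comb_add Pi_iff)

lemma comb_nat_bij:
  assumes "m > 0"
  shows "bij_betw (\<lambda>c. comb m (int \<circ> c)) ({..<r} \<rightarrow>\<^sub>E {..<m}) (mtorsion A m)"
  using basis assms by (simp add: tate_basis_def basis_comb_def int_pow_int)

text \<open>\<open>tate_basis\<close> speaks of exponents in \<open>{..<m}\<close>, so both
  coordinate vectors are first reduced to that range.\<close>

lemma comb_eq_iff:
  assumes "m > 0"
  shows "comb m c = comb m d \<longleftrightarrow> (\<forall>i<r. c i mod int m = d i mod int m)"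
proof
  assume eq: "comb m c = comb m d"
  define res where "res c = (\<lambda>i\<in>{..<r}. nat (c i mod int m))" for c
  have res: "res c \<in> {..<r} \<rightarrow>\<^sub>E {..<m}" "comb m (int \<circ> res c) = comb m c" for c
  proof -
    show "res c \<in> {..<r} \<rightarrow>\<^sub>E {..<m}"
      using assms by (auto simp: res_def nat_less_iff)
    show "comb m (int \<circ> res c) = comb m c"
      using assms by (intro comb_cong) (auto simp: res_def)
  qed
  have "res c = res d"
    using bij_betw_imp_inj_on[OF comb_nat_bij[OF assms]] res eq by (metis (no_types, lifting) inj_onD)
  show "\<forall>i<r. c i mod int m = d i mod int m"
  proof (intro allI impI)
    fix i assume i: "i < r"
    have "nat (c i mod int m) = nat (d i mod int m)"
      using fun_cong[OF \<open>res c = res d\<close>, of i] i by (simp add: res_def)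
    then show "c i mod int m = d i mod int m"
      using assms by (subst (asm) eq_nat_nat_iff) simp_all
  qed
qed (blast intro: comb_cong)

lemma comb_eq_one_iff: "m > 0 \<Longrightarrow> comb m c = \<one> \<longleftrightarrow> (\<forall>i<r. int m dvd c i)"
  using comb_eq_iff[of m c "\<lambda>i. 0"] by (simp add: dvd_eq_mod_eq_0)

lemma mtorsion_comb:
  assumes "m > 0" "x \<in> mtorsion A m"
  shows "\<exists>c. x = comb m c"
  using bij_betw_imp_surj_on[OF comb_nat_bij[OF assms(1)]] assms(2) by (metis imageE)

lemma card_mtorsion: "m > 0 \<Longrightarrow> card (mtorsion A m) = m ^ r"
  using bij_betw_same_card[OF comb_nat_bij[of m]] by (simp add: card_PiE)

text \<open>\<open>M j\<close> is the \<open>j\<close>-th column of the matrix of \<open>h\<close>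
  at level \<open>m\<close>, so this is the product of that matrix with the coordinate
  vector.\<close>

lemma hom_comb:
  assumes h: "h \<in> hom A A" and M: "\<And>j. j < r \<Longrightarrow> h (b j m) = comb m (M j)"
  shows "h (comb m c) = comb m (\<lambda>i. \<Sum>j<r. c j * M j i)"
proof -
  interpret h: group_hom A A h by unfold_locales (rule h)
  have hom_finprod: "h (finprod A f J) = finprod A (h \<circ> f) J" if "finite J" "f \<in> J \<rightarrow> carrier A" for f and J :: "nat set"
    using that
  proof (induction J rule: finite_induct)
    case (insert j J)
    then have "f j \<in> carrier A" "f \<in> J \<rightarrow> carrier A" "h (f j) \<in> carrier A" "(\<lambda>a. h (f a)) \<in> J \<rightarrow> carrier A"
      using h.hom_closed by (auto simp: Pi_iff)
    then show ?case using insert by simp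
  qed simp
  have "h (comb m c) = (\<Otimes>j\<in>{..<r}. comb m (\<lambda>i. c j * M j i))"
    unfolding basis_comb_def[of A r b m c]
    by (subst hom_finprod) (auto simp: h.hom_int_pow M comb_scale intro!: finprod_cong')
  also have "\<dots> = comb m (\<lambda>i. \<Sum>j<r. c j * M j i)"
    by (rule comb_sum[symmetric]) simp
  finally show ?thesis .
qed

section \<open>Profinite coordinates of elements of the Tate module\<close>

lemma tate_mult: "s \<otimes>\<^bsub>tate_module A\<^esub> t = (\<lambda>m. s m \<otimes> t m)"
  and tate_one: "\<one>\<^bsub>tate_module A\<^esub> = (\<lambda>m. \<one>)"
  by (simp_all add: tate_module_def)

lemma mem_tate_moduleI:
  assumes "t 0 = \<one>" "\<And>m. t m \<in> carrier A" "\<And>m. t m [^] m = \<one>"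
    "\<And>m n. 0 < n \<Longrightarrow> m dvd n \<Longrightarrow> t n [^] (n div m) = t m"
  shows "t \<in> carrier (tate_module A)"
  using assms by (simp add: tate_module_def mtorsion_def)

lemma tate_module_comm_monoid: "comm_monoid (tate_module A)"
proof (rule comm_monoidI)
  show "\<one>\<^bsub>tate_module A\<^esub> \<in> carrier (tate_module A)"
    unfolding tate_one by (rule mem_tate_moduleI) simp_all
next
  fix s t assume s: "s \<in> carrier (tate_module A)" and t: "t \<in> carrier (tate_module A)"
  have pow: "(s m \<otimes> t m) [^] (k::nat) = s m [^] k \<otimes> t m [^] k" for m k
    using tate_moduleD(2)[OF s] tate_moduleD(2)[OF t] by (intro pow_mult_distrib m_comm)
  show "s \<otimes>\<^bsub>tate_module A\<^esub> t \<in> carrier (tate_module A)"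
    unfolding tate_mult
    by (rule mem_tate_moduleI) (simp_all only: pow tate_moduleD[OF s] tate_moduleD[OF t] m_closed l_one one_closed)
  show "s \<otimes>\<^bsub>tate_module A\<^esub> t = t \<otimes>\<^bsub>tate_module A\<^esub> s"
    unfolding tate_mult by (intro ext m_comm tate_moduleD(2) s t)
next
  fix s t u
  assume "s \<in> carrier (tate_module A)" "t \<in> carrier (tate_module A)" "u \<in> carrier (tate_module A)"
  then show "s \<otimes>\<^bsub>tate_module A\<^esub> t \<otimes>\<^bsub>tate_module A\<^esub> u = s \<otimes>\<^bsub>tate_module A\<^esub> (t \<otimes>\<^bsub>tate_module A\<^esub> u)"
    unfolding tate_mult by (intro ext m_assoc tate_moduleD(2))
next
  fix t assume "t \<in> carrier (tate_module A)"
  then show "\<one>\<^bsub>tate_module A\<^esub> \<otimes>\<^bsub>tate_module A\<^esub> t = t"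
    unfolding tate_mult tate_one by (intro ext l_one tate_moduleD(2))
qed

lemma tate_finprod_apply:
  assumes "finite J" "f \<in> J \<rightarrow> carrier (tate_module A)"
  shows "(\<Otimes>\<^bsub>tate_module A\<^esub>i\<in>J. f i) m = (\<Otimes>i\<in>J. f i m)"
proof -
  interpret T: comm_monoid "tate_module A" by (rule tate_module_comm_monoid)
  have [simp]: "(s \<otimes>\<^bsub>tate_module A\<^esub> t) m = s m \<otimes> t m" "\<one>\<^bsub>tate_module A\<^esub> m = \<one>" for s t
    by (simp_all add: tate_mult tate_one)
  show ?thesis
    using assms
  proof (induction J rule: finite_induct)
    case (insert i J)
    have "f j m \<in> carrier A" if "j \<in> insert i J" for j
      using insert.prems that by (intro tate_moduleD(2)) auto
    then show ?case
      using insert by (simp add: Pi_iff)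
  qed simp
qed

lemma zhat_scale_closed:
  assumes t: "t \<in> carrier (tate_module A)"
  shows "zhat_scale A a t \<in> carrier (tate_module A)"
proof -
  have "(t m [^] residue a m) [^] m = \<one>" for m
  proof -
    have "(t m [^] residue a m) [^] (int m) = (t m [^] (int m)) [^] residue a m"
      using tate_moduleD(2)[OF t] by (simp add: int_pow_pow mult.commute)
    then show ?thesis using tate_moduleD(3)[OF t] by (simp add: int_pow_int)
  qed
  moreover have "(t n [^] residue a n) [^] (n div m) = t m [^] residue a m" if "0 < n" "m dvd n" for m n
  proof -
    have m: "m > 0" using that dvd_pos_nat by blast
    have tm: "t m [^] (int m) = \<one>" using tate_moduleD(3)[OF t] by (simp add: int_pow_int)
    have "residue a n mod int m = residue a m"
      using that by transfer auto
    then have "t m [^] residue a n = t m [^] (int m * (residue a n div int m) + residue a m)"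
      by (metis mult_div_mod_eq)
    also have "\<dots> = t m [^] residue a m"
      using tate_moduleD(2)[OF t] by (simp add: int_pow_mult tm flip: int_pow_pow)
    finally have eq: "t m [^] residue a n = t m [^] residue a m" .
    have "(t n [^] residue a n) [^] (int (n div m)) = (t n [^] (int (n div m))) [^] residue a n"
      using tate_moduleD(2)[OF t] by (simp add: int_pow_pow mult.commute)
    then show ?thesis using tate_moduleD(4)[OF t that] eq by (simp add: int_pow_int)
  qed
  ultimately show ?thesis
    using tate_moduleD(1,2)[OF t] by (intro mem_tate_moduleI) (simp_all add: zhat_scale_def)
qed

lemma tate_comb_apply:
  "(\<Otimes>\<^bsub>tate_module A\<^esub>i\<in>{..<r}. zhat_scale A (a i) (b i)) m = comb m (\<lambda>i. residue (a i) m)"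
  by (subst tate_finprod_apply) (auto simp: zhat_scale_closed b_mem_tate_module basis_comb_def zhat_scale_def)

text \<open>Integer coordinates are chosen level by level. Being unique modulo \<open>m\<close>,
  they are compatible and assemble into profinite integers.\<close>

lemma tate_coordinates_exist:
  assumes t: "t \<in> carrier (tate_module A)"
  shows "\<exists>a. \<forall>m. t m = comb m (\<lambda>i. residue (a i) m)"
proof -
  have "\<exists>c. t m = comb m c" if "m > 0" for m
    by (rule mtorsion_comb[OF that]) (simp add: mtorsion_def tate_moduleD(2,3)[OF t])
  then obtain c where c: "\<And>m. m > 0 \<Longrightarrow> t m = comb m (c m)" by metis
  have compat: "c n i mod int m = c m i mod int m" if "0 < n" "m dvd n" "i < r" for m n i
  proof -
    have m: "m > 0" using that dvd_pos_nat by blast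
    have level: "b j n [^] (int (n div m)) = b j m" if "j < r" for j
      using tate_moduleD(4)[OF b_mem_tate_module[OF that] \<open>0 < n\<close> \<open>m dvd n\<close>] by (simp add: int_pow_int)
    have "comb m (c m) = comb n (c n) [^] (n div m)"
      using tate_moduleD(4)[OF t that(1,2)] c that(1) m by simp
    also have "\<dots> = comb n (\<lambda>i. int (n div m) * c n i)"
      by (simp add: comb_scale_nat)
    \<comment> \<open>Multiplication by \<open>n div m\<close> carries the basis at level
      \<open>n\<close> to the basis at level \<open>m\<close>, so \<open>c n\<close> also gives
      coordinates of \<open>t m\<close>.\<close>
    also have "\<dots> = comb m (c n)"
      unfolding basis_comb_def by (intro finprod_cong') (auto simp: level[symmetric] int_pow_pow)
    finally show ?thesis
      using comb_eq_iff[OF m] that(3) by metis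
  qed
  define a where "a i = Abs_zhat (\<lambda>m. if m = 0 then 0 else c m i mod int m)" for i
  have residue_a: "residue (a i) m = c m i mod int m" if "i < r" "m > 0" for i m
  proof -
    have "(\<lambda>m. if m = 0 then 0 else c m i mod int m) \<in>
        {a. a 0 = 0 \<and> (\<forall>m n. 0 < n \<and> m dvd n \<longrightarrow> a n mod int m = a m)}"
    proof (intro CollectI conjI allI impI)
      fix m n :: nat assume mn: "0 < n \<and> m dvd n"
      then have "m > 0" using dvd_pos_nat by blast
      then show "(if n = 0 then 0 else c n i mod int n) mod int m = (if m = 0 then 0 else c m i mod int m)"
        using mn compat[of n m i] that(1) mod_mod_cancel[of "int m" "int n" "c n i"] by simp
    qed simp
    then show ?thesis
      using that(2) by (simp add: a_def Abs_zhat_inverse)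
  qed
  have "t m = comb m (\<lambda>i. residue (a i) m)" for m
  proof (cases "m = 0")
    case True
    then show ?thesis using tate_moduleD(1)[OF t] by simp
  next
    case False
    then have "t m = comb m (c m)" using c by simp
    also have "\<dots> = comb m (\<lambda>i. residue (a i) m)"
      by (rule comb_cong) (use False residue_a in simp)
    finally show ?thesis .
  qed
  then show ?thesis by blast
qed

lemma tate_coordinates_unique:
  assumes "\<And>m. comb m (\<lambda>i. residue (a i) m) = comb m (\<lambda>i. residue (a' i) m)" and "i < r"
  shows "a i = a' i"
proof (rule zhat_eqI)
  fix m :: nat assume m: "m > 0"
  then show "residue (a i) m = residue (a' i) m"
    using assms comb_eq_iff[OF m] residue_mod[OF m] by metis
qed

lemma hom_mem_tate_module:
  assumes h: "h \<in> hom A A" and t: "t \<in> carrier (tate_module A)"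
  shows "(\<lambda>m. h (t m)) \<in> carrier (tate_module A)"
proof -
  interpret h: group_hom A A h by unfold_locales (rule h)
  show ?thesis
    using tate_moduleD[OF t] by (intro mem_tate_moduleI) (simp_all flip: h.hom_nat_pow)
qed

end

section \<open>The matrix of a Galois element\<close>

text \<open>\<open>adelic_rep\<close> is a definite description. It is identified here from the
  action at each level; uniqueness is that of profinite coordinates.\<close>

lemma adelic_rep_eqI:
  assumes "tate_basis_group A (2 * g) b"
    and M: "M \<in> carrier_mat (2 * g) (2 * g)"
    and act: "\<And>j m. j < 2 * g \<Longrightarrow> gal_act \<sigma> (b j m) = basis_comb A (2 * g) b m (\<lambda>i. residue (M $$ (i, j)) m)"
  shows "adelic_rep A g b \<sigma> = M"
proof -
  interpret tate_basis_group A "2 * g" b by fact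
  show ?thesis
    unfolding adelic_rep_def
  proof (rule the_equality)
    show "M \<in> carrier_mat (2 * g) (2 * g) \<and>
      (\<forall>j<2 * g. (\<lambda>m. gal_act \<sigma> (b j m)) =
        (\<Otimes>\<^bsub>tate_module A\<^esub>i\<in>{..<2 * g}. zhat_scale A (M $$ (i, j)) (b i)))"
      using M act by (auto simp: fun_eq_iff tate_comb_apply)
    fix M' assume M': "M' \<in> carrier_mat (2 * g) (2 * g) \<and>
      (\<forall>j<2 * g. (\<lambda>m. gal_act \<sigma> (b j m)) =
        (\<Otimes>\<^bsub>tate_module A\<^esub>i\<in>{..<2 * g}. zhat_scale A (M' $$ (i, j)) (b i)))"
    show "M' = M"
    proof (rule eq_matI)
      fix i j assume ij: "i < dim_row M" "j < dim_col M"
      have "comb m (\<lambda>i. residue (M' $$ (i, j)) m) = comb m (\<lambda>i. residue (M $$ (i, j)) m)" for m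
        using M' act[of j m] ij M by (auto simp: fun_eq_iff tate_comb_apply)
      then show "M' $$ (i, j) = M $$ (i, j)"
        using ij M by (intro tate_coordinates_unique[of "\<lambda>i. M' $$ (i, j)" "\<lambda>i. M $$ (i, j)"]) auto
    qed (use M M' in auto)
  qed
qed

text \<open>The description has a witness whenever \<sigma> acts by a homomorphism: its columns are
  the profinite coordinates of the images of the basis vectors.\<close>

lemma adelic_rep_apply:
  assumes "tate_basis_group A (2 * g) b" and h: "gal_act \<sigma> \<in> hom A A" and j: "j < 2 * g"
  shows "gal_act \<sigma> (b j m) = basis_comb A (2 * g) b m (\<lambda>i. residue (adelic_rep A g b \<sigma> $$ (i, j)) m)"
proof -
  interpret tate_basis_group A "2 * g" b by fact
  have "\<exists>a. \<forall>m. gal_act \<sigma> (b j m) = comb m (\<lambda>i. residue (a i) m)" if "j < 2 * g" for j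
    by (rule tate_coordinates_exist[OF hom_mem_tate_module[OF h b_mem_tate_module[OF that]]])
  then obtain a where a: "\<And>j m. j < 2 * g \<Longrightarrow> gal_act \<sigma> (b j m) = comb m (\<lambda>i. residue (a j i) m)"
    by metis
  define M where "M = mat (2 * g) (2 * g) (\<lambda>(i, j). a j i)"
  have act: "gal_act \<sigma> (b j m) = comb m (\<lambda>i. residue (M $$ (i, j)) m)" if "j < 2 * g" for j m
    unfolding a[OF that] by (rule comb_cong) (simp add: M_def that)
  have "adelic_rep A g b \<sigma> = M"
    by (rule adelic_rep_eqI[OF assms(1) _ act]) (simp add: M_def)
  then show ?thesis using act[OF j] by simp
qed

lemma adelic_rep_id:
  assumes "tate_basis_group A (2 * g) b"
  shows "adelic_rep A g b id = 1\<^sub>m (2 * g)"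
proof -
  interpret tate_basis_group A "2 * g" b by fact
  show ?thesis
  proof (rule adelic_rep_eqI[OF assms])
    fix j m assume j: "j < 2 * g"
    show "gal_act id (b j m) = comb m (\<lambda>i. residue (1\<^sub>m (2 * g) $$ (i, j)) m)"
    \<comment> \<open>The residue of 1 at level 0 is 0, so \<open>comb_unit\<close> does not match
      there; both sides are then neutral.\<close>
    proof (cases "m = 0")
      case True
      then show ?thesis using tate_moduleD(1)[OF b_mem_tate_module[OF j]] by (simp add: gal_act_id)
    next
      case False
      have "comb m (\<lambda>i. residue (1\<^sub>m (2 * g) $$ (i, j)) m) = comb m (\<lambda>i. if i = j then 1 else 0)"
        by (rule comb_cong) (use j False in \<open>auto simp: one_zhat.rep_eq zero_zhat.rep_eq\<close>)
      then show ?thesis using j by (simp add: comb_unit gal_act_id)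
    qed
  qed simp
qed

section \<open>Unipotent symplectic matrices\<close>

text \<open>Together with \<open>lower_unip\<close>: the elementary matrices of SL_2, repeated on
  each of the \<open>g\<close> planes spanned by the basis vectors \<open>i\<close> and
  \<open>i + g\<close>. Both families are additive in \<open>z\<close>.\<close>

definition upper_unip :: "nat \<Rightarrow> 'r::comm_ring_1 \<Rightarrow> 'r mat" where
  "upper_unip g z = four_block_mat (1\<^sub>m g) (z \<cdot>\<^sub>m 1\<^sub>m g) (0\<^sub>m g g) (1\<^sub>m g)"

definition lower_unip :: "nat \<Rightarrow> 'r::comm_ring_1 \<Rightarrow> 'r mat" where
  "lower_unip g z = four_block_mat (1\<^sub>m g) (0\<^sub>m g g) (z \<cdot>\<^sub>m 1\<^sub>m g) (1\<^sub>m g)"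

lemma symp_mat_block:
  "symp_mat g = four_block_mat (0\<^sub>m g g) (1\<^sub>m g) (- 1\<^sub>m g) (0\<^sub>m g g :: 'r::comm_ring_1 mat)"
  by (rule eq_matI) (auto simp: symp_mat_def symp_form_def)

lemma smult_one_mat_mult: "A \<in> carrier_mat n n \<Longrightarrow> (z \<cdot>\<^sub>m 1\<^sub>m n) * A = z \<cdot>\<^sub>m (A :: 'r::comm_ring_1 mat)"
  by (metis left_mult_one_mat mult_smult_assoc_mat one_carrier_mat)

lemma mult_smult_one_mat: "A \<in> carrier_mat n n \<Longrightarrow> A * (z \<cdot>\<^sub>m 1\<^sub>m n) = z \<cdot>\<^sub>m (A :: 'r::comm_ring_1 mat)"
  by (metis right_mult_one_mat mult_smult_distrib one_carrier_mat)

lemma uminus_zero_mat: "- 0\<^sub>m n m = (0\<^sub>m n m :: 'r::comm_ring_1 mat)"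
  by (rule eq_matI) auto

lemma transpose_smult_one: "(z \<cdot>\<^sub>m 1\<^sub>m n)\<^sup>T = (z \<cdot>\<^sub>m 1\<^sub>m n :: 'r::comm_ring_1 mat)"
  by (rule eq_matI) auto

lemma upper_unip_symplectic:
  "(upper_unip g z)\<^sup>T * symp_mat g * upper_unip g z = (symp_mat g :: 'r::comm_ring_1 mat)"
proof -
  have T: "(upper_unip g z)\<^sup>T = four_block_mat (1\<^sub>m g) (0\<^sub>m g g) (z \<cdot>\<^sub>m 1\<^sub>m g) (1\<^sub>m g)"
    unfolding upper_unip_def by (subst transpose_four_block_mat[of _ g g _ g _ g]) (simp_all add: transpose_smult_one)
  have "(upper_unip g z)\<^sup>T * symp_mat g = four_block_mat (0\<^sub>m g g) (1\<^sub>m g) (- 1\<^sub>m g) (z \<cdot>\<^sub>m 1\<^sub>m g)"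
    unfolding T symp_mat_block
    by (subst mult_four_block_mat[of _ g g _ g _ g _ _ g _ g]) (simp_all add: smult_one_mat_mult uminus_zero_mat)
  also have "\<dots> * upper_unip g z = symp_mat g"
    unfolding upper_unip_def symp_mat_block
    by (subst mult_four_block_mat[of _ g g _ g _ g _ _ g _ g])
      (simp_all add: mult_smult_one_mat, auto intro!: cong_four_block_mat eq_matI)
  finally show ?thesis .
qed

lemma lower_unip_symplectic:
  "(lower_unip g z)\<^sup>T * symp_mat g * lower_unip g z = (symp_mat g :: 'r::comm_ring_1 mat)"
proof -
  have T: "(lower_unip g z)\<^sup>T = four_block_mat (1\<^sub>m g) (z \<cdot>\<^sub>m 1\<^sub>m g) (0\<^sub>m g g) (1\<^sub>m g)"
    unfolding lower_unip_def by (subst transpose_four_block_mat[of _ g g _ g _ g]) (simp_all add: transpose_smult_one)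
  have "(lower_unip g z)\<^sup>T * symp_mat g = four_block_mat (- (z \<cdot>\<^sub>m 1\<^sub>m g)) (1\<^sub>m g) (- 1\<^sub>m g) (0\<^sub>m g g)"
    unfolding T symp_mat_block
    by (subst mult_four_block_mat[of _ g g _ g _ g _ _ g _ g])
      (auto simp: smult_one_mat_mult uminus_zero_mat intro!: cong_four_block_mat eq_matI)
  also have "\<dots> * lower_unip g z = symp_mat g"
    unfolding lower_unip_def symp_mat_block
    by (subst mult_four_block_mat[of _ g g _ g _ g _ _ g _ g])
      (simp_all add: mult_smult_one_mat, auto intro!: cong_four_block_mat eq_matI)
  finally show ?thesis .
qed

lemma upper_unip_add: "upper_unip g y * upper_unip g z = upper_unip g (y + z :: 'r::comm_ring_1)"
  unfolding upper_unip_def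
  by (subst mult_four_block_mat[of _ g g _ g _ g _ _ g _ g])
    (simp_all add: mult_smult_one_mat, auto intro!: cong_four_block_mat eq_matI)

lemma lower_unip_add: "lower_unip g y * lower_unip g z = lower_unip g (y + z :: 'r::comm_ring_1)"
  unfolding lower_unip_def
  by (subst mult_four_block_mat[of _ g g _ g _ g _ _ g _ g])
    (simp_all add: mult_smult_one_mat, auto intro!: cong_four_block_mat eq_matI)

lemma unip_0: "upper_unip g 0 = 1\<^sub>m (2 * g)" "lower_unip g 0 = 1\<^sub>m (2 * g)"
  by (rule eq_matI; auto simp: upper_unip_def lower_unip_def)+

lemma unip_mem_Sp: "upper_unip g z \<in> carrier (Sp g)" "lower_unip g z \<in> carrier (Sp g)"
  using upper_unip_symplectic[of g z] lower_unip_symplectic[of g z]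
  by (auto simp: Sp_def upper_unip_def lower_unip_def mult_2)

text \<open>Pigeonhole: \<open>H u(i) = H u(j)\<close> for some \<open>i < j\<close>. Since \<open>1 \<in> H\<close>, this gives \<open>u(j) = h u(i)\<close> with
  \<open>h \<in> H\<close>, that is, \<open>u(j - i) = h\<close>.\<close>

lemma one_parameter_meets_finite_index:
  fixes u :: "int \<Rightarrow> zhat mat"
  assumes fin: "finite (rcosets\<^bsub>Sp g\<^esub> H)" and H: "H \<subseteq> carrier (Sp g)" "1\<^sub>m (2 * g) \<in> H"
    and u: "\<And>i. u i \<in> carrier (Sp g)" "\<And>i j. u i * u j = u (i + j)" "u 0 = 1\<^sub>m (2 * g)"
  obtains r :: nat where "r > 0" "u (int r) \<in> H"
proof -
  have c: "M \<in> carrier_mat (2 * g) (2 * g)" if "M \<in> carrier (Sp g)" for M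
    using that by (simp add: Sp_def)
  have mult: "M \<otimes>\<^bsub>Sp g\<^esub> N = M * N" for M N
    by (simp add: Sp_def)
  let ?C = "\<lambda>i :: nat. H #>\<^bsub>Sp g\<^esub> u (int i)"
  have "range ?C \<subseteq> rcosets\<^bsub>Sp g\<^esub> H"
    using u(1) by (auto simp: RCOSETS_def)
  then have "finite (range ?C)"
    using fin finite_subset by blast
  then have "\<not> inj ?C"
    using finite_imageD infinite_UNIV_nat by blast
  then obtain i j :: nat where ij: "?C i = ?C j" "i < j"
    unfolding inj_on_def by (metis linorder_neqE_nat)
  have "u (int j) \<in> ?C j"
    unfolding r_coset_def mult
  proof (rule UN_I[OF H(2)])
    show "u (int j) \<in> {1\<^sub>m (2 * g) * u (int j)}"
      using left_mult_one_mat[OF c[OF u(1)]] by simp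
  qed
  then obtain h where h: "h \<in> H" "u (int j) = h * u (int i)"
    unfolding ij(1)[symmetric] by (auto simp: r_coset_def mult)
  have "u (int j) * u (- int i) = h * (u (int i) * u (- int i))"
    unfolding h(2) using h(1) H(1) by (intro assoc_mult_mat[of _ "2*g" "2*g" _ "2*g" _ "2*g"]) (auto intro!: c u(1))
  then have "u (int j - int i) = h"
    using right_mult_one_mat[OF c[OF subsetD[OF H(1) h(1)]]] by (simp add: u(2,3))
  then show thesis
    using h(1) ij(2) by (intro that[of "j - i"]) (simp_all add: of_nat_diff)
qed

section \<open>Unipotent action on coordinates\<close>

context tate_basis_group
begin

lemma hom_upper_unip:
  assumes h: "h \<in> hom A A" and r: "r = 2 * g" and m: "m > 0"
    and act: "\<And>j. j < r \<Longrightarrow> h (b j m) = comb m (\<lambda>i. residue (upper_unip g (of_int z) $$ (i, j)) m)"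
  shows "h (comb m c) = comb m (\<lambda>i. if i < g then c i + z * c (i + g) else c i)"
proof -
  let ?M = "\<lambda>j i. if i = j then 1 else if j = i + g then z else 0 :: int"
  have "h (b j m) = comb m (?M j)" if "j < r" for j
    unfolding act[OF that] using m that r
    by (intro comb_cong) (auto simp: upper_unip_def residue_of_int one_zhat.rep_eq zero_zhat.rep_eq)
  then have "h (comb m c) = comb m (\<lambda>i. \<Sum>j<r. c j * ?M j i)"
    by (rule hom_comb[OF h])
  also have "\<dots> = comb m (\<lambda>i. if i < g then c i + z * c (i + g) else c i)"
  proof (rule comb_cong)
    fix i assume i: "i < r"
    have "(\<Sum>j<r. c j * ?M j i) = (\<Sum>j<r. (if j = i then c j else 0) + (if j = i + g then z * c j else 0))"
      using i r by (intro sum.cong) auto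
    also have "\<dots> = (if i < g then c i + z * c (i + g) else c i)"
      using i r by (simp add: sum.distrib)
    finally show "(\<Sum>j<r. c j * ?M j i) mod int m = (if i < g then c i + z * c (i + g) else c i) mod int m"
      by simp
  qed
  finally show ?thesis .
qed

lemma hom_lower_unip:
  assumes h: "h \<in> hom A A" and r: "r = 2 * g" and m: "m > 0"
    and act: "\<And>j. j < r \<Longrightarrow> h (b j m) = comb m (\<lambda>i. residue (lower_unip g (of_int z) $$ (i, j)) m)"
  shows "h (comb m c) = comb m (\<lambda>i. if g \<le> i \<and> i < r then c i + z * c (i - g) else c i)"
proof -
  let ?M = "\<lambda>j i. if i = j then 1 else if i = j + g then z else 0 :: int"
  have "h (b j m) = comb m (?M j)" if "j < r" for j
    unfolding act[OF that] using m that r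
    by (intro comb_cong) (auto simp: lower_unip_def residue_of_int one_zhat.rep_eq zero_zhat.rep_eq)
  then have "h (comb m c) = comb m (\<lambda>i. \<Sum>j<r. c j * ?M j i)"
    by (rule hom_comb[OF h])
  also have "\<dots> = comb m (\<lambda>i. if g \<le> i \<and> i < r then c i + z * c (i - g) else c i)"
  proof (rule comb_cong)
    fix i assume i: "i < r"
    \<comment> \<open>The inner condition guards against truncation: for \<open>i < g\<close> the
      index \<open>i - g\<close> is 0 and must contribute nothing.\<close>
    have "(\<Sum>j<r. c j * ?M j i) = (\<Sum>j<r. (if j = i then c j else 0) + (if j = i - g then (if i < g then 0 else z * c j) else 0))"
      using i r by (intro sum.cong) auto
    also have "\<dots> = (if g \<le> i \<and> i < r then c i + z * c (i - g) else c i)"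
      using i r by (auto simp: sum.distrib)
    finally show "(\<Sum>j<r. c j * ?M j i) mod int m = (if g \<le> i \<and> i < r then c i + z * c (i - g) else c i) mod int m"
      by simp
  qed
  finally show ?thesis .
qed

end

section \<open>Bounding the torsion\<close>

lemma (in tate_basis_group) funpow_comb:
  assumes "\<And>c. h (comb m c) = comb m (T c)"
  shows "(h ^^ k) (comb m c) = comb m ((T ^^ k) c)"
  by (induction k) (simp_all add: assms)

text \<open>In coordinates \<open>c\<close> of \<open>x\<close>, the unipotents first show that
  \<open>p ^ k * r * s\<close> kills \<open>c\<close>. The coordinates along the orbit of \<sigma>
  \<circ> \<tau> then form a periodic recurrence, which removes the factor
  \<open>p ^ k\<close>.\<close>

lemma torsion_point_pow_eq_one:
  fixes A :: "'a::field ppoint monoid"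
  assumes A: "abelian_variety K n A" and tate: "tate_basis_group A (2 * g) b"
    and \<sigma>: "\<sigma> \<in> carrier (Gal UNIV K)" "adelic_rep A g b \<sigma> = upper_unip g (of_int (int r))"
    and \<tau>: "\<tau> \<in> carrier (Gal UNIV K)" "adelic_rep A g b \<tau> = lower_unip g (of_int (int s))"
    and p: "Factorial_Ring.prime p" "\<not> p dvd r * s"
    and x: "x \<in> mtorsion A m" "m > 0"
    and fixed: "\<And>\<rho>. \<rho> \<in> carrier (Gal UNIV K) \<Longrightarrow> (gal_act \<rho> ^^ (p ^ k)) x = x"
  shows "x [^]\<^bsub>A\<^esub> (r * s) = \<one>\<^bsub>A\<^esub>"
proof -
  interpret tate_basis_group A "2 * g" b by fact
  define up :: "(nat \<Rightarrow> int) \<Rightarrow> nat \<Rightarrow> int"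
    where "up c = (\<lambda>i. if i < g then c i + int r * c (i + g) else c i)" for c
  define lo :: "(nat \<Rightarrow> int) \<Rightarrow> nat \<Rightarrow> int"
    where "lo c = (\<lambda>i. if g \<le> i \<and> i < 2 * g then c i + int s * c (i - g) else c i)" for c
  define T where "T c = up (lo c)" for c
  define J where "J = int r * int s"
  define q where "q = p ^ k"
  have act_\<sigma>: "gal_act \<sigma> (comb m c) = comb m (up c)" for c
    unfolding up_def
    by (rule hom_upper_unip[OF gal_act_hom[OF A \<sigma>(1)] refl x(2)])
      (use adelic_rep_apply[OF tate gal_act_hom[OF A \<sigma>(1)]] \<sigma>(2) in simp)
  have act_\<tau>: "gal_act \<tau> (comb m c) = comb m (lo c)" for c
    unfolding lo_def
    by (rule hom_lower_unip[OF gal_act_hom[OF A \<tau>(1)] refl x(2)])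
      (use adelic_rep_apply[OF tate gal_act_hom[OF A \<tau>(1)]] \<tau>(2) in simp)
  have act_T: "gal_act (\<sigma> \<circ> \<tau>) (comb m c) = comb m (T c)" for c
    by (simp add: act_\<sigma> act_\<tau> T_def flip: gal_act_comp)
  obtain c where c: "x = comb m c"
    using mtorsion_comb[OF x(2,1)] by blast
  \<comment> \<open>\<open>up\<close> leaves the coordinates with \<open>i \<ge> g\<close> unchanged
    and adds multiples of them, so its iterates grow linearly; \<open>lo\<close> does the same with
    the halves exchanged.\<close>
  have up_pow: "(up ^^ j) c = (\<lambda>i. if i < g then c i + int j * int r * c (i + g) else c i)" for j
    by (induction j) (auto simp: up_def fun_eq_iff algebra_simps)
  have lo_pow: "(lo ^^ j) c = (\<lambda>i. if g \<le> i \<and> i < 2 * g then c i + int j * int s * c (i - g) else c i)" for j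
    by (induction j) (auto simp: lo_def fun_eq_iff algebra_simps)
  \<comment> \<open>\<open>lo\<close> adds a multiple of coordinate \<open>i\<close> to coordinate
    \<open>i + g\<close>, and \<open>up\<close> to coordinate \<open>i - g\<close>. That this
    coordinate returns modulo \<open>m\<close> after \<open>q\<close> steps gives the divisibility,
    up to a factor \<open>r\<close> or \<open>s\<close> that is multiplied in.\<close>
  have dvd: "int m dvd int q * J * c i" if i: "i < 2 * g" for i
  proof (cases "i < g")
    case True
    have "comb m ((lo ^^ q) c) = comb m c"
      using fixed[OF \<tau>(1)] unfolding c q_def funpow_comb[where T = lo, OF act_\<tau>] .
    then have "(lo ^^ q) c (i + g) mod int m = c (i + g) mod int m"
      using True comb_eq_iff[OF x(2)] by auto
    then have "int m dvd int q * int s * c i"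
      using True by (simp add: lo_pow mod_eq_dvd_iff)
    then have "int m dvd int r * (int q * int s * c i)" by (rule dvd_mult)
    then show ?thesis by (simp add: J_def mult_ac)
  next
    case False
    have "comb m ((up ^^ q) c) = comb m c"
      using fixed[OF \<sigma>(1)] unfolding c q_def funpow_comb[where T = up, OF act_\<sigma>] .
    then have "(up ^^ q) c (i - g) mod int m = c (i - g) mod int m"
      using i comb_eq_iff[OF x(2)] by auto
    moreover have "i - g < g" "i - g + g = i" using i False by simp_all
    ultimately have "int m dvd int q * int r * c i"
      by (simp add: up_pow mod_eq_dvd_iff)
    then have "int m dvd int s * (int q * int r * c i)" by (rule dvd_mult)
    then show ?thesis by (simp add: J_def mult_ac)
  qed
  have T_dvd: "int m dvd e * T d i" if "\<And>i. i < 2 * g \<Longrightarrow> int m dvd e * d i" "i < 2 * g" for e d i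
    using that by (auto simp: T_def up_def lo_def distrib_left mult.left_commute[of e] intro!: dvd_add dvd_mult)
  have T_pow_dvd: "int m dvd (int q * J) * (T ^^ j) c i" if "i < 2 * g" for i j
    using that
  proof (induction j arbitrary: i)
    case (Suc j)
    then show ?case using T_dvd[of "int q * J" "(T ^^ j) c" i] by simp
  qed (simp add: dvd)
  \<comment> \<open>Cayley-Hamilton: on the indices \<open>i\<close> and \<open>i + g\<close> the
    matrix of \<open>T\<close> has rows (1 + r s, r) and (s, 1), with trace \<open>2 + J\<close> and
    determinant 1.\<close>
  have T_rec: "T (T d) i = (2 + J) * T d i - d i" if "i < 2 * g" for d i
    using that by (auto simp: T_def up_def lo_def J_def algebra_simps)
  \<comment> \<open>\<sigma> \<circ> \<tau> is itself a Galois element, so its \<open>q\<close>-th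
    iterate fixes \<open>x\<close>.\<close>
  have T_per: "(T ^^ (j + q)) c i mod int m = (T ^^ j) c i mod int m" if "i < 2 * g" for i j
  proof -
    have "comb m ((T ^^ (j + q)) c) = (gal_act (\<sigma> \<circ> \<tau>) ^^ j) ((gal_act (\<sigma> \<circ> \<tau>) ^^ q) x)"
      by (simp add: c funpow_comb[where T = T, OF act_T] funpow_add)
    also have "\<dots> = comb m ((T ^^ j) c)"
      using fixed[OF Gal_UNIV_comp[OF \<sigma>(1) \<tau>(1)]]
      by (simp add: q_def) (simp add: c funpow_comb[where T = T, OF act_T])
    finally show ?thesis
      using comb_eq_iff[OF x(2)] that by blast
  qed
  have "\<not> int p dvd J"
    using p(2) by (simp add: J_def flip: of_nat_mult)
  \<comment> \<open>The recurrence is taken for \<open>J\<close> times the coordinate, because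
    \<open>T_pow_dvd\<close> says that \<open>q * J\<close> times the coordinate vanishes modulo
    \<open>m\<close>; as \<open>q = p ^ k\<close>, this is the torsion hypothesis with
    \<open>l = k\<close>. Index 0 returns \<open>c\<close> itself.\<close>
  have "int m dvd J * (T ^^ 0) c i" if i: "i < 2 * g" for i
  proof (rule periodic_recurrence_dvd_modulus[OF p(1) \<open>\<not> int p dvd J\<close>, where k = k and l = k
        and f = "\<lambda>j. J * (T ^^ j) c i" and n = 0])
    fix j
    have "(T ^^ (j + 2)) c i = (2 + J) * (T ^^ (j + 1)) c i - (T ^^ j) c i"
      using T_rec[OF i, of "(T ^^ j) c"] by simp
    then show "J * (T ^^ (j + 2)) c i = (2 + J) * (J * (T ^^ (j + 1)) c i) - J * (T ^^ j) c i"
      by (simp only: right_diff_distrib mult.left_commute)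
    show "int m dvd J * (T ^^ (j + p ^ k)) c i - J * (T ^^ j) c i"
      using T_per[OF i, of j] by (simp add: q_def mod_eq_dvd_iff flip: right_diff_distrib)
    show "int m dvd int p ^ k * (J * (T ^^ j) c i)"
      using T_pow_dvd[OF i, of j] by (simp add: q_def mult.assoc)
  qed
  then have "comb m (\<lambda>i. int (r * s) * c i) = \<one>\<^bsub>A\<^esub>"
    by (simp add: comb_eq_one_iff[OF x(2)] J_def)
  then show ?thesis
    by (simp only: comb_scale_nat c)
qed

text \<open>Each unipotent family is a one-parameter subgroup of \<open>Sp g\<close>, so it meets
  the image at a positive integer parameter; \<sigma> and \<tau> are Galois preimages.\<close>

lemma big_image_contains_unipotents:
  fixes A :: "'a::field ppoint monoid"
  assumes tate: "tate_basis_group A (2 * g) b" and big: "big_image K A g b"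
  obtains r s :: nat and \<sigma> \<tau> where "r > 0" "s > 0"
    "\<sigma> \<in> carrier (Gal UNIV K)" "adelic_rep A g b \<sigma> = upper_unip g (of_int (int r))"
    "\<tau> \<in> carrier (Gal UNIV K)" "adelic_rep A g b \<tau> = lower_unip g (of_int (int s))"
proof -
  let ?H = "adelic_rep A g b ` carrier (Gal UNIV K) \<inter> carrier (Sp g)"
  have fin: "finite (rcosets\<^bsub>Sp g\<^esub> ?H)"
    using big by (simp add: big_image_def)
  \<comment> \<open>The identity automorphism puts the unit matrix into \<open>?H\<close>, as the
    pigeonhole argument requires.\<close>
  have one: "1\<^sub>m (2 * g) \<in> ?H"
    using adelic_rep_id[OF tate] Gal_UNIV_id[of K] unip_mem_Sp(1)[of g 0] unip_0(1)[where 'a = zhat, of g]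
    by (metis IntI imageI)
  obtain r :: nat where r: "r > 0" "upper_unip g (of_int (int r)) \<in> ?H"
    by (rule one_parameter_meets_finite_index[OF fin Int_lower2 one, of "\<lambda>i. upper_unip g (of_int i)"])
      (simp_all only: unip_mem_Sp upper_unip_add of_int_add of_int_0 unip_0)
  obtain s :: nat where s: "s > 0" "lower_unip g (of_int (int s)) \<in> ?H"
    by (rule one_parameter_meets_finite_index[OF fin Int_lower2 one, of "\<lambda>i. lower_unip g (of_int i)"])
      (simp_all only: unip_mem_Sp lower_unip_add of_int_add of_int_0 unip_0)
  from r s show thesis
    by (elim IntE imageE) (rule that[of r s]; simp)
qed

theorem theorem3p14:
  fixes K :: "'a::{alg_closed_field, field_char_0} set"
    and A :: "'a ppoint monoid"
    and n g :: nat
  assumes "number_field K"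
    and "type_is_algebraic_closure K"
    and "abelian_variety K n A"
    and "zariski_dim n (carrier A) = enat g"
    and "\<exists>D b. polarization K n A D \<and> symplectic_tate_basis n A D g b \<and> big_image K A g b"
  shows "\<exists>C::real. C > 0 \<and>
    (\<exists>p0::nat. \<forall>p. Factorial_Ring.prime p \<and> p \<ge> p0 \<longrightarrow>
      (\<forall>L. galois_extension L K \<and> pro_p_Gal p L K \<longrightarrow>
        finite (torsion_points A \<inter> rational_points L A) \<and>
        real (card (torsion_points A \<inter> rational_points L A)) < C))"
proof -
  obtain D b where D: "symplectic_tate_basis n A D g b" and big: "big_image K A g b"
    using assms(5) by (elim exE conjE)
  have tate: "tate_basis_group A (2 * g) b"
    using assms(3) D
    by (intro tate_basis_group.intro tate_basis_group_axioms.intro)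
      (simp_all add: abelian_variety_def symplectic_tate_basis_def)
  interpret tate_basis_group A "2 * g" b by (rule tate)
  obtain r s :: nat and \<sigma> \<tau> where rs: "r > 0" "s > 0"
    and \<sigma>: "\<sigma> \<in> carrier (Gal UNIV K)" "adelic_rep A g b \<sigma> = upper_unip g (of_int (int r))"
    and \<tau>: "\<tau> \<in> carrier (Gal UNIV K)" "adelic_rep A g b \<tau> = lower_unip g (of_int (int s))"
    by (rule big_image_contains_unipotents[OF tate big])
  \<comment> \<open>The bound is the order of \<open>A[r s]\<close>, with \<open>r\<close> and
    \<open>s\<close> fixed before \<open>p\<close> and \<open>L\<close>.\<close>
  let ?N = "(r * s) ^ (2 * g)"
  have card: "card (mtorsion A (r * s)) = ?N" "?N > 0"
    using card_mtorsion[of "r * s"] rs by simp_all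
  have fin: "finite (mtorsion A (r * s))"
    by (rule card_ge_0_finite) (use card in simp)
  \<comment> \<open>\<open>Suc ?N\<close> makes the inequality strict. The threshold
    \<open>Suc (r * s)\<close> keeps \<open>p\<close> from dividing the positive number
    \<open>r * s\<close>.\<close>
  have "finite (torsion_points A \<inter> rational_points L A) \<and>
      real (card (torsion_points A \<inter> rational_points L A)) < real (Suc ?N)"
    if p: "Factorial_Ring.prime p" "p \<ge> Suc (r * s)" and L: "galois_extension L K" "pro_p_Gal p L K" for p L
  proof -
    have ndvd: "\<not> p dvd r * s"
      using p(2) rs by (intro nat_dvd_not_less) auto
    have "torsion_points A \<inter> rational_points L A \<subseteq> mtorsion A (r * s)"
    proof
      fix x assume x: "x \<in> torsion_points A \<inter> rational_points L A"
      then obtain m :: nat where m: "m > 0" "x \<in> mtorsion A m"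
        by (auto simp: torsion_points_def mtorsion_def)
      \<comment> \<open>The exponent \<open>k\<close> depends on \<open>x\<close>, but the resulting
        bound \<open>r * s\<close> on the order does not involve it.\<close>
      obtain k where "\<And>\<rho>. \<rho> \<in> carrier (Gal UNIV K) \<Longrightarrow> (gal_act \<rho> ^^ (p ^ k)) x = x"
        using pro_p_Gal_fixes_rational_point[OF assms(2) L assms(3)] x by blast
      from torsion_point_pow_eq_one[OF assms(3) tate \<sigma> \<tau> p(1) ndvd m(2,1) this]
      show "x \<in> mtorsion A (r * s)"
        using m(2) by (simp add: mtorsion_def)
    qed
    then have "finite (torsion_points A \<inter> rational_points L A)"
      and "card (torsion_points A \<inter> rational_points L A) < Suc ?N"
      using fin card(1) by (auto intro: finite_subset dest: card_mono[OF fin])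
    then show ?thesis by (simp only: of_nat_less_iff)
  qed
  moreover have "real (Suc ?N) > 0"
    by (simp only: of_nat_0_less_iff zero_less_Suc)
  ultimately show ?thesis
    by blast
qed

end
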